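(* Let $h\colon Y\to Z$ be a morphism of schemes having the same underlying topological space. Let $X$ be an infinitesimal extension of $Y$ by a coherent sheaf $\mathcal{F}$, such that $h$ factors through a morphism $X\to Z$ (i.e. $\mathcal{O}_X$ is an $\mathcal{O}_Z$-algebra), and suppose the extension is split as an extension of $\mathcal{O}_Z$-modules. Then $\mathcal{O}_X\cong\mathcal{O}_Y\oplus\mathcal{F}$ as $\mathcal{O}_Z$-modules, and the ring structure is defined by a map $f\in\mathrm{Hom}_Z(\mathcal{O}_Y\otimes_{\mathcal{O}_Z}\mathcal{O}_Y,\mathcal{F})$ such that: 1. If $U\subset Y$ is open affine, then $$r_0f(r_1,r_2)-f(r_0r_1,r_2)+f(r_0,r_1r_2)-f(r_0,r_1)r_2=0$$ for all $r_i\in\mathcal{O}_Y(U)$. 2. $f(r_0,r_1)=f(r_1,r_0)$ for all $r_i\in\mathcal{O}_Y(U)$, i.e. $f$ is symmetric. 3. The multiplication is defined by $$(x,m)(x',m')=(xx',\,xm'+x'm+f(x,x'))$$ for $x,x'\in\mathcal{O}_Y(U)$ and $m,m'\in\mathcal{F}(U)$. It is associative by 1, commutative by 2, and the unit is $(1,-f(1,1))$.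
   Context: An infinitesimal extension of $Y$ by a coherent $\mathcal{O}_Y$-module $\mathcal{F}$ is a scheme $X$ with the same underlying topological space as $Y$, together with a surjection of sheaves of rings $\mathcal{O}_X\to\mathcal{O}_Y$ whose kernel is a square-zero ideal identified, as an $\mathcal{O}_Y$-module, with $\mathcal{F}$. That $h$ factors through $X\to Z$ means that $h$ is the composition $Y\hookrightarrow X\to Z$. The underlying map of $h$ is the identity on the common topological space, and $\mathrm{Hom}_Z$ denotes $\mathcal{O}_Z$-linear homomorphisms of sheaves on that space; $f(r_0,r_1)$ means $f(r_0\otimes r_1)$. *)

theory Defs
  imports "HOL-Algebra.Module" "HOL-Algebra.Ideal" "HOL-Algebra.QuotRing"
    "HOL-Algebra.Generated_Groups" "HOL-Algebra.Free_Abelian_Groups"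
    "HOL-Analysis.Abstract_Topology"
begin

section \<open>Presheaves and sheaves\<close>

text \<open>
  The extension slot \<open>'e\<close> is \<open>unit\<close> for sheaves of rings and the scalar multiplication for
  sheaves of modules. As everywhere in HOL-Algebra, the fields \<open>mult\<close> and \<open>one\<close> of a module
  carry no meaning. All conditions on (pre)sheaves are relativised to the open sets of a given
  topology, so a sheaf on \<open>T\<close> is restricted to an open set \<open>U\<close> by passing to
  \<open>subtopology T U\<close> and keeping the same record.
\<close>

record ('p, 's, 'e) presheaf =
  sections :: "'p set \<Rightarrow> ('s, 'e) ring_scheme"
  restr :: "'p set \<Rightarrow> 'p set \<Rightarrow> 's \<Rightarrow> 's"

type_synonym ('p, 's) ring_presheaf = "('p, 's, unit) presheaf"
type_synonym ('p, 'r, 's) module_presheaf = "('p, 's, ('r, 's, unit) module_ext) presheaf"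

locale sheaf =
  fixes T :: "'p topology" and F :: "('p, 's, 'e) presheaf"
  assumes restr_closed: "\<lbrakk>openin T U; openin T V; V \<subseteq> U; s \<in> carrier (sections F U)\<rbrakk>
      \<Longrightarrow> restr F U V s \<in> carrier (sections F V)"
    and restr_id: "\<lbrakk>openin T U; s \<in> carrier (sections F U)\<rbrakk> \<Longrightarrow> restr F U U s = s"
    and restr_comp: "\<lbrakk>openin T U; openin T V; openin T W; W \<subseteq> V; V \<subseteq> U;
        s \<in> carrier (sections F U)\<rbrakk> \<Longrightarrow> restr F V W (restr F U V s) = restr F U W s"
    and locality: "\<lbrakk>\<And>V. V \<in> \<U> \<Longrightarrow> openin T V;
        s \<in> carrier (sections F (\<Union>\<U>)); t \<in> carrier (sections F (\<Union>\<U>));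
        \<And>V. V \<in> \<U> \<Longrightarrow> restr F (\<Union>\<U>) V s = restr F (\<Union>\<U>) V t\<rbrakk> \<Longrightarrow> s = t"
    and gluing: "\<lbrakk>\<And>V. V \<in> \<U> \<Longrightarrow> openin T V;
        \<And>V. V \<in> \<U> \<Longrightarrow> c V \<in> carrier (sections F V);
        \<And>V W. \<lbrakk>V \<in> \<U>; W \<in> \<U>\<rbrakk> \<Longrightarrow> restr F V (V \<inter> W) (c V) = restr F W (V \<inter> W) (c W)\<rbrakk>
      \<Longrightarrow> \<exists>t \<in> carrier (sections F (\<Union>\<U>)). \<forall>V \<in> \<U>. restr F (\<Union>\<U>) V t = c V"

locale ringed_space = sheaf T \<O> for T :: "'p topology" and \<O> :: "('p, 's) ring_presheaf" +
  assumes sections_cring: "openin T U \<Longrightarrow> cring (sections \<O> U)"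
    and restr_ring_hom: "\<lbrakk>openin T U; openin T V; V \<subseteq> U\<rbrakk>
      \<Longrightarrow> restr \<O> U V \<in> ring_hom (sections \<O> U) (sections \<O> V)"

locale module_sheaf = base: ringed_space T \<O> + sheaf T F
  for T :: "'p topology" and \<O> :: "('p, 'r) ring_presheaf" and F :: "('p, 'r, 's) module_presheaf" +
  assumes sections_module: "openin T U \<Longrightarrow> Module.module (sections \<O> U) (sections F U)"
    and restr_add: "\<lbrakk>openin T U; openin T V; V \<subseteq> U;
        s \<in> carrier (sections F U); t \<in> carrier (sections F U)\<rbrakk>
      \<Longrightarrow> restr F U V (s \<oplus>\<^bsub>sections F U\<^esub> t) = restr F U V s \<oplus>\<^bsub>sections F V\<^esub> restr F U V t"
    and restr_smult: "\<lbrakk>openin T U; openin T V; V \<subseteq> U;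
        a \<in> carrier (sections \<O> U); s \<in> carrier (sections F U)\<rbrakk>
      \<Longrightarrow> restr F U V (a \<odot>\<^bsub>sections F U\<^esub> s) = restr \<O> U V a \<odot>\<^bsub>sections F V\<^esub> restr F U V s"

definition germ :: "'p topology \<Rightarrow> ('p, 's, 'e) presheaf \<Rightarrow> 'p \<Rightarrow> 'p set \<Rightarrow> 's \<Rightarrow> ('p set \<times> 's) set" where
  "germ T F x U s = {(V, t). openin T V \<and> x \<in> V \<and> t \<in> carrier (sections F V) \<and>
     (\<exists>W. openin T W \<and> x \<in> W \<and> W \<subseteq> U \<inter> V \<and> restr F U W s = restr F V W t)}"

text \<open>
  Operations on equivalence classes (germs, fractions, cosets) are written throughout as unions
  over all representatives; every member of such a union is the same class.
\<close>

definition stalk_add :: "'p topology \<Rightarrow> ('p, 's, 'e) presheaf \<Rightarrow> 'p \<Rightarrow>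
    ('p set \<times> 's) set \<Rightarrow> ('p set \<times> 's) set \<Rightarrow> ('p set \<times> 's) set" where
  "stalk_add T F x A B = (\<Union>(U, s) \<in> A. \<Union>(V, t) \<in> B. germ T F x (U \<inter> V)
     (restr F U (U \<inter> V) s \<oplus>\<^bsub>sections F (U \<inter> V)\<^esub> restr F V (U \<inter> V) t))"

definition stalk_mult :: "'p topology \<Rightarrow> ('p, 's, 'e) presheaf \<Rightarrow> 'p \<Rightarrow>
    ('p set \<times> 's) set \<Rightarrow> ('p set \<times> 's) set \<Rightarrow> ('p set \<times> 's) set" where
  "stalk_mult T F x A B = (\<Union>(U, s) \<in> A. \<Union>(V, t) \<in> B. germ T F x (U \<inter> V)
     (restr F U (U \<inter> V) s \<otimes>\<^bsub>sections F (U \<inter> V)\<^esub> restr F V (U \<inter> V) t))"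

definition stalk :: "'p topology \<Rightarrow> ('p, 's) ring_presheaf \<Rightarrow> 'p \<Rightarrow> ('p set \<times> 's) set ring" where
  "stalk T \<O> x = \<lparr>carrier = {germ T \<O> x U s | U s. openin T U \<and> x \<in> U \<and> s \<in> carrier (sections \<O> U)},
     mult = stalk_mult T \<O> x,
     one = germ T \<O> x (topspace T) \<one>\<^bsub>sections \<O> (topspace T)\<^esub>,
     ring.zero = germ T \<O> x (topspace T) \<zero>\<^bsub>sections \<O> (topspace T)\<^esub>,
     add = stalk_add T \<O> x\<rparr>"


section \<open>Affine schemes\<close>

definition local_ring :: "('a, 'm) ring_scheme \<Rightarrow> bool" where
  "local_ring R \<longleftrightarrow> cring R \<and> (\<exists>!I. maximalideal I R)"

definition local_ring_hom :: "('a, 'm) ring_scheme \<Rightarrow> ('b, 'n) ring_scheme \<Rightarrow> ('a \<Rightarrow> 'b) \<Rightarrow> bool" where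
  "local_ring_hom R S \<phi> \<longleftrightarrow> \<phi> \<in> ring_hom R S \<and>
     (\<forall>I J. maximalideal I R \<longrightarrow> maximalideal J S \<longrightarrow> {a \<in> carrier R. \<phi> a \<in> J} = I)"

definition fraction :: "'a ring \<Rightarrow> 'a set \<Rightarrow> 'a \<Rightarrow> 'a \<Rightarrow> ('a \<times> 'a) set" where
  "fraction A P a f = {(b, g). b \<in> carrier A \<and> g \<in> carrier A - P \<and>
     (\<exists>u \<in> carrier A - P. u \<otimes>\<^bsub>A\<^esub> (a \<otimes>\<^bsub>A\<^esub> g) = u \<otimes>\<^bsub>A\<^esub> (b \<otimes>\<^bsub>A\<^esub> f))}"

definition localization_at :: "'a ring \<Rightarrow> 'a set \<Rightarrow> ('a \<times> 'a) set ring" where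
  "localization_at A P = \<lparr>carrier = {fraction A P a f | a f. a \<in> carrier A \<and> f \<in> carrier A - P},
     mult = (\<lambda>x y. \<Union>(a, f) \<in> x. \<Union>(b, g) \<in> y. fraction A P (a \<otimes>\<^bsub>A\<^esub> b) (f \<otimes>\<^bsub>A\<^esub> g)),
     one = fraction A P \<one>\<^bsub>A\<^esub> \<one>\<^bsub>A\<^esub>,
     ring.zero = fraction A P \<zero>\<^bsub>A\<^esub> \<one>\<^bsub>A\<^esub>,
     add = (\<lambda>x y. \<Union>(a, f) \<in> x. \<Union>(b, g) \<in> y.
        fraction A P ((a \<otimes>\<^bsub>A\<^esub> g) \<oplus>\<^bsub>A\<^esub> (b \<otimes>\<^bsub>A\<^esub> f)) (f \<otimes>\<^bsub>A\<^esub> g))\<rparr>"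

definition zariski_open :: "'a ring \<Rightarrow> 'a set set \<Rightarrow> bool" where
  "zariski_open A U \<longleftrightarrow> (\<exists>E \<subseteq> carrier A. U = {P. primeideal P A \<and> \<not> E \<subseteq> P})"

definition spec_top :: "'a ring \<Rightarrow> 'a set topology" where
  "spec_top A = topology (zariski_open A)"

lemma istopology_zariski_open: "istopology (zariski_open A)"
  unfolding istopology_def
proof (intro conjI allI impI)
  fix S S' assume "zariski_open A S" "zariski_open A S'"
  then obtain E E' where E: "E \<subseteq> carrier A" "S = {P. primeideal P A \<and> \<not> E \<subseteq> P}"
    and E': "E' \<subseteq> carrier A" "S' = {P. primeideal P A \<and> \<not> E' \<subseteq> P}"
    unfolding zariski_open_def by blast
  let ?D = "{e \<otimes>\<^bsub>A\<^esub> e' | e e'. e \<in> E \<and> e' \<in> E'} \<inter> carrier A"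
  have "\<not> ?D \<subseteq> P \<longleftrightarrow> \<not> E \<subseteq> P \<and> \<not> E' \<subseteq> P" if P: "primeideal P A" for P
  proof -
    interpret primeideal P A by (rule P)
    show ?thesis
    proof
      assume "\<not> ?D \<subseteq> P"
      then obtain e e' where "e \<in> E" "e' \<in> E'" "e \<otimes>\<^bsub>A\<^esub> e' \<notin> P" by blast
      then show "\<not> E \<subseteq> P \<and> \<not> E' \<subseteq> P"
        using E(1) E'(1) I_l_closed I_r_closed by blast
    next
      assume "\<not> E \<subseteq> P \<and> \<not> E' \<subseteq> P"
      then obtain e e' where e: "e \<in> E" "e' \<in> E'" "e \<notin> P" "e' \<notin> P" by blast
      then have "e \<otimes>\<^bsub>A\<^esub> e' \<notin> P" "e \<otimes>\<^bsub>A\<^esub> e' \<in> carrier A"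
        using I_prime E(1) E'(1) by blast+
      then show "\<not> ?D \<subseteq> P" using e by blast
    qed
  qed
  then have "S \<inter> S' = {P. primeideal P A \<and> \<not> ?D \<subseteq> P}" using E(2) E'(2) by blast
  then show "zariski_open A (S \<inter> S')" unfolding zariski_open_def by blast
next
  fix \<K> assume K: "\<forall>K \<in> \<K>. zariski_open A K"
  let ?D = "\<Union>{E. E \<subseteq> carrier A \<and> {P. primeideal P A \<and> \<not> E \<subseteq> P} \<in> \<K>}"
  have "\<Union>\<K> = {P. primeideal P A \<and> \<not> ?D \<subseteq> P}" (is "_ = ?R")
  proof
    show "\<Union>\<K> \<subseteq> ?R"
    proof
      fix P assume "P \<in> \<Union>\<K>"
      then obtain K where "K \<in> \<K>" "P \<in> K" by blast
      moreover then obtain E where "E \<subseteq> carrier A" "K = {P. primeideal P A \<and> \<not> E \<subseteq> P}"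
        using K unfolding zariski_open_def by blast
      ultimately show "P \<in> ?R" by blast
    qed
  qed blast
  moreover have "?D \<subseteq> carrier A" by blast
  ultimately show "zariski_open A (\<Union>\<K>)" unfolding zariski_open_def by blast
qed

lemma openin_spec_top: "openin (spec_top A) U \<longleftrightarrow> zariski_open A U"
  by (simp add: spec_top_def istopology_zariski_open)

definition spec_sections :: "'a ring \<Rightarrow> 'a set set \<Rightarrow> ('a set \<Rightarrow> ('a \<times> 'a) set) ring" where
  "spec_sections A U = \<lparr>carrier = {s \<in> extensional U. \<forall>P \<in> U. \<exists>V a f.
       openin (spec_top A) V \<and> P \<in> V \<and> V \<subseteq> U \<and> a \<in> carrier A \<and> f \<in> carrier A \<and>
       (\<forall>Q \<in> V. f \<notin> Q \<and> s Q = fraction A Q a f)},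
     mult = (\<lambda>s t. \<lambda>P \<in> U. s P \<otimes>\<^bsub>localization_at A P\<^esub> t P),
     one = (\<lambda>P \<in> U. \<one>\<^bsub>localization_at A P\<^esub>),
     ring.zero = (\<lambda>P \<in> U. \<zero>\<^bsub>localization_at A P\<^esub>),
     add = (\<lambda>s t. \<lambda>P \<in> U. s P \<oplus>\<^bsub>localization_at A P\<^esub> t P)\<rparr>"

definition spec_sheaf :: "'a ring \<Rightarrow> ('a set, 'a set \<Rightarrow> ('a \<times> 'a) set) ring_presheaf" where
  "spec_sheaf A = \<lparr>sections = spec_sections A, restr = (\<lambda>U V s. restrict s V)\<rparr>"

text \<open>
  The pair \<open>(\<phi>, \<psi>)\<close> consists of a homeomorphism and an isomorphism of sheaves from \<open>\<P>\<close> to the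
  direct image of \<open>\<O>\<close>. Such a pair induces isomorphisms on stalks, so between locally ringed
  spaces it is automatically an isomorphism of locally ringed spaces.
\<close>

definition ringed_space_iso :: "'p topology \<Rightarrow> ('p, 's) ring_presheaf \<Rightarrow> 'q topology \<Rightarrow>
    ('q, 't) ring_presheaf \<Rightarrow> ('p \<Rightarrow> 'q) \<Rightarrow> ('q set \<Rightarrow> 't \<Rightarrow> 's) \<Rightarrow> bool" where
  "ringed_space_iso T \<O> S \<P> \<phi> \<psi> \<longleftrightarrow> homeomorphic_map T S \<phi> \<and>
     (\<forall>V. openin S V \<longrightarrow>
        \<psi> V \<in> ring_iso (sections \<P> V) (sections \<O> {x \<in> topspace T. \<phi> x \<in> V})) \<and>
     (\<forall>V W s. openin S V \<longrightarrow> openin S W \<longrightarrow> W \<subseteq> V \<longrightarrow> s \<in> carrier (sections \<P> V) \<longrightarrow>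
        \<psi> W (restr \<P> V W s) =
        restr \<O> {x \<in> topspace T. \<phi> x \<in> V} {x \<in> topspace T. \<phi> x \<in> W} (\<psi> V s))"

text \<open>
  Taking \<open>A\<close> over the type of sections of \<open>\<O>\<close> is no restriction: if \<open>(U, \<O>|U)\<close> is isomorphic to
  the spectrum of some ring, then that ring is isomorphic to \<open>sections \<O> U\<close>.
\<close>

definition affine_open :: "'p topology \<Rightarrow> ('p, 's) ring_presheaf \<Rightarrow> 'p set \<Rightarrow> bool" where
  "affine_open T \<O> U \<longleftrightarrow> openin T U \<and> (\<exists>(A :: 's ring) \<phi> \<psi>. cring A \<and>
     ringed_space_iso (subtopology T U) \<O> (spec_top A) (spec_sheaf A) \<phi> \<psi>)"


section \<open>Schemes and morphisms that are the identity on the underlying space\<close>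

locale scheme = ringed_space T \<O> for T :: "'p topology" and \<O> :: "('p, 's) ring_presheaf" +
  assumes stalk_local: "x \<in> topspace T \<Longrightarrow> local_ring (stalk T \<O> x)"
    and locally_affine: "x \<in> topspace T \<Longrightarrow> \<exists>U. affine_open T \<O> U \<and> x \<in> U"

definition natural_map :: "'p topology \<Rightarrow> ('p, 's, 'e) presheaf \<Rightarrow> ('p, 't, 'd) presheaf \<Rightarrow>
    ('p set \<Rightarrow> 's \<Rightarrow> 't) \<Rightarrow> bool" where
  "natural_map T F G \<phi> \<longleftrightarrow> (\<forall>U V s. openin T U \<longrightarrow> openin T V \<longrightarrow> V \<subseteq> U \<longrightarrow>
     s \<in> carrier (sections F U) \<longrightarrow> \<phi> V (restr F U V s) = restr G U V (\<phi> U s))"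

definition ring_sheaf_hom :: "'p topology \<Rightarrow> ('p, 's) ring_presheaf \<Rightarrow> ('p, 't) ring_presheaf \<Rightarrow>
    ('p set \<Rightarrow> 's \<Rightarrow> 't) \<Rightarrow> bool" where
  "ring_sheaf_hom T \<A> \<B> \<phi> \<longleftrightarrow> natural_map T \<A> \<B> \<phi> \<and>
     (\<forall>U. openin T U \<longrightarrow> \<phi> U \<in> ring_hom (sections \<A> U) (sections \<B> U))"

definition stalk_map :: "'p topology \<Rightarrow> ('p, 't) ring_presheaf \<Rightarrow> ('p set \<Rightarrow> 's \<Rightarrow> 't) \<Rightarrow> 'p \<Rightarrow>
    ('p set \<times> 's) set \<Rightarrow> ('p set \<times> 't) set" where
  "stalk_map T \<B> \<phi> x C = (\<Union>(U, s) \<in> C. germ T \<B> x U (\<phi> U s))"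

text \<open>
  A morphism of schemes \<open>(T, \<O>\<^sub>Y) \<rightarrow> (T, \<O>\<^sub>Z)\<close> whose underlying map is the identity, given by its
  comorphism \<open>h : \<O>\<^sub>Z \<rightarrow> \<O>\<^sub>Y\<close>.
\<close>

definition scheme_morphism :: "'p topology \<Rightarrow> ('p, 'y) ring_presheaf \<Rightarrow> ('p, 'z) ring_presheaf \<Rightarrow>
    ('p set \<Rightarrow> 'z \<Rightarrow> 'y) \<Rightarrow> bool" where
  "scheme_morphism T \<O>\<^sub>Y \<O>\<^sub>Z h \<longleftrightarrow> ring_sheaf_hom T \<O>\<^sub>Z \<O>\<^sub>Y h \<and>
     (\<forall>x \<in> topspace T. local_ring_hom (stalk T \<O>\<^sub>Z x) (stalk T \<O>\<^sub>Y x) (stalk_map T \<O>\<^sub>Y h x))"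


section \<open>Sheaves of modules\<close>

definition with_smult :: "('s, 'e) ring_scheme \<Rightarrow> ('r \<Rightarrow> 's \<Rightarrow> 's) \<Rightarrow> ('r, 's) module" where
  "with_smult M sm = \<lparr>carrier = carrier M, mult = monoid.mult M, one = one M, ring.zero = ring.zero M, add = add M,
     smult = sm\<rparr>"

definition algebra_sheaf :: "('p set \<Rightarrow> 'r \<Rightarrow> 's) \<Rightarrow> ('p, 's) ring_presheaf \<Rightarrow>
    ('p, 'r, 's) module_presheaf" where
  "algebra_sheaf \<phi> \<B> =
     \<lparr>sections = (\<lambda>U. with_smult (sections \<B> U) (\<lambda>r s. \<phi> U r \<otimes>\<^bsub>sections \<B> U\<^esub> s)),
      restr = restr \<B>\<rparr>"

definition restrict_scalars :: "('p set \<Rightarrow> 'r \<Rightarrow> 'a) \<Rightarrow> ('p, 'a, 's) module_presheaf \<Rightarrow>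
    ('p, 'r, 's) module_presheaf" where
  "restrict_scalars \<phi> F =
     \<lparr>sections = (\<lambda>U. with_smult (sections F U) (\<lambda>r s. \<phi> U r \<odot>\<^bsub>sections F U\<^esub> s)),
      restr = restr F\<rparr>"

definition direct_sum :: "('p, 'r, 's) module_presheaf \<Rightarrow> ('p, 'r, 't) module_presheaf \<Rightarrow>
    ('p, 'r, 's \<times> 't) module_presheaf" where
  "direct_sum F G =
     \<lparr>sections = (\<lambda>U. \<lparr>carrier = carrier (sections F U) \<times> carrier (sections G U),
        mult = undefined, one = undefined,
        ring.zero = (\<zero>\<^bsub>sections F U\<^esub>, \<zero>\<^bsub>sections G U\<^esub>),
        add = (\<lambda>(s, t) (s', t'). (s \<oplus>\<^bsub>sections F U\<^esub> s', t \<oplus>\<^bsub>sections G U\<^esub> t')),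
        smult = (\<lambda>r (s, t). (r \<odot>\<^bsub>sections F U\<^esub> s, r \<odot>\<^bsub>sections G U\<^esub> t))\<rparr>),
      restr = (\<lambda>U V (s, t). (restr F U V s, restr G U V t))\<rparr>"

definition linear_maps :: "('r, 'e) ring_scheme \<Rightarrow> ('r, 's, 'm) module_scheme \<Rightarrow>
    ('r, 't, 'n) module_scheme \<Rightarrow> ('s \<Rightarrow> 't) set" where
  "linear_maps R M N = {\<phi>. \<phi> \<in> carrier M \<rightarrow> carrier N \<and>
     (\<forall>s \<in> carrier M. \<forall>t \<in> carrier M. \<phi> (s \<oplus>\<^bsub>M\<^esub> t) = \<phi> s \<oplus>\<^bsub>N\<^esub> \<phi> t) \<and>
     (\<forall>r \<in> carrier R. \<forall>s \<in> carrier M. \<phi> (r \<odot>\<^bsub>M\<^esub> s) = r \<odot>\<^bsub>N\<^esub> \<phi> s)}"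

definition module_sheaf_hom :: "'p topology \<Rightarrow> ('p, 'r) ring_presheaf \<Rightarrow>
    ('p, 'r, 's) module_presheaf \<Rightarrow> ('p, 'r, 't) module_presheaf \<Rightarrow> ('p set \<Rightarrow> 's \<Rightarrow> 't) \<Rightarrow> bool" where
  "module_sheaf_hom T \<O> F G \<phi> \<longleftrightarrow> natural_map T F G \<phi> \<and>
     (\<forall>U. openin T U \<longrightarrow> \<phi> U \<in> linear_maps (sections \<O> U) (sections F U) (sections G U))"

definition module_sheaf_iso :: "'p topology \<Rightarrow> ('p, 'r) ring_presheaf \<Rightarrow>
    ('p, 'r, 's) module_presheaf \<Rightarrow> ('p, 'r, 't) module_presheaf \<Rightarrow> ('p set \<Rightarrow> 's \<Rightarrow> 't) \<Rightarrow> bool" where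
  "module_sheaf_iso T \<O> F G \<phi> \<longleftrightarrow> module_sheaf_hom T \<O> F G \<phi> \<and>
     (\<forall>U. openin T U \<longrightarrow> bij_betw (\<phi> U) (carrier (sections F U)) (carrier (sections G U)))"

subsection \<open>Coherence\<close>

definition finite_type :: "'p topology \<Rightarrow> ('p, 'r) ring_presheaf \<Rightarrow> ('p, 'r, 's) module_presheaf \<Rightarrow> bool" where
  "finite_type T \<O> F \<longleftrightarrow> (\<forall>x \<in> topspace T. \<exists>U n (s :: nat \<Rightarrow> 's).
     openin T U \<and> x \<in> U \<and> s \<in> {..<n} \<rightarrow> carrier (sections F U) \<and>
     (\<forall>V t y. openin T V \<longrightarrow> V \<subseteq> U \<longrightarrow> t \<in> carrier (sections F V) \<longrightarrow> y \<in> V \<longrightarrow>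
        (\<exists>W c. openin T W \<and> y \<in> W \<and> W \<subseteq> V \<and> c \<in> {..<n} \<rightarrow> carrier (sections \<O> W) \<and>
           restr F V W t =
           (\<Oplus>\<^bsub>sections F W\<^esub> i \<in> {..<n}. c i \<odot>\<^bsub>sections F W\<^esub> restr F U W (s i)))))"

text \<open>The kernel of the map \<open>\<O>|U\<^sup>n \<rightarrow> F|U\<close> given by sections \<open>s 0, \<dots>, s (n - 1)\<close> of \<open>F\<close> over \<open>U\<close>.\<close>

definition relation_sheaf :: "('p, 'r) ring_presheaf \<Rightarrow> ('p, 'r, 's) module_presheaf \<Rightarrow> 'p set \<Rightarrow>
    nat \<Rightarrow> (nat \<Rightarrow> 's) \<Rightarrow> ('p, 'r, nat \<Rightarrow> 'r) module_presheaf" where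
  "relation_sheaf \<O> F U n s =
     \<lparr>sections = (\<lambda>V. \<lparr>carrier = {c \<in> {..<n} \<rightarrow>\<^sub>E carrier (sections \<O> V).
           (\<Oplus>\<^bsub>sections F V\<^esub> i \<in> {..<n}. c i \<odot>\<^bsub>sections F V\<^esub> restr F U V (s i)) = \<zero>\<^bsub>sections F V\<^esub>},
        mult = undefined, one = undefined,
        ring.zero = (\<lambda>i \<in> {..<n}. \<zero>\<^bsub>sections \<O> V\<^esub>),
        add = (\<lambda>c d. \<lambda>i \<in> {..<n}. c i \<oplus>\<^bsub>sections \<O> V\<^esub> d i),
        smult = (\<lambda>a c. \<lambda>i \<in> {..<n}. a \<otimes>\<^bsub>sections \<O> V\<^esub> c i)\<rparr>),
      restr = (\<lambda>V W c. \<lambda>i \<in> {..<n}. restr \<O> V W (c i))\<rparr>"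

definition coherent_sheaf :: "'p topology \<Rightarrow> ('p, 'r) ring_presheaf \<Rightarrow> ('p, 'r, 's) module_presheaf \<Rightarrow> bool" where
  "coherent_sheaf T \<O> F \<longleftrightarrow> module_sheaf T \<O> F \<and> finite_type T \<O> F \<and>
     (\<forall>U n s. openin T U \<longrightarrow> s \<in> {..<n} \<rightarrow> carrier (sections F U) \<longrightarrow>
        finite_type (subtopology T U) \<O> (relation_sheaf \<O> F U n s))"

subsection \<open>Tensor products\<close>

definition tensor_relations :: "('r, 'e) ring_scheme \<Rightarrow> ('r, 's, 'm) module_scheme \<Rightarrow>
    ('r, 't, 'n) module_scheme \<Rightarrow> ('s \<times> 't \<Rightarrow>\<^sub>0 int) set" where
  "tensor_relations R M N =
     {frag_of (m \<oplus>\<^bsub>M\<^esub> m', n) - frag_of (m, n) - frag_of (m', n) | m m' n.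
        m \<in> carrier M \<and> m' \<in> carrier M \<and> n \<in> carrier N} \<union>
     {frag_of (m, n \<oplus>\<^bsub>N\<^esub> n') - frag_of (m, n) - frag_of (m, n') | m n n'.
        m \<in> carrier M \<and> n \<in> carrier N \<and> n' \<in> carrier N} \<union>
     {frag_of (r \<odot>\<^bsub>M\<^esub> m, n) - frag_of (m, r \<odot>\<^bsub>N\<^esub> n) | r m n.
        r \<in> carrier R \<and> m \<in> carrier M \<and> n \<in> carrier N}"

definition tensor_kernel :: "('r, 'e) ring_scheme \<Rightarrow> ('r, 's, 'm) module_scheme \<Rightarrow>
    ('r, 't, 'n) module_scheme \<Rightarrow> ('s \<times> 't \<Rightarrow>\<^sub>0 int) set" where
  "tensor_kernel R M N =
     generate (free_Abelian_group (carrier M \<times> carrier N)) (tensor_relations R M N)"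

definition tensor_group :: "('r, 'e) ring_scheme \<Rightarrow> ('r, 's, 'm) module_scheme \<Rightarrow>
    ('r, 't, 'n) module_scheme \<Rightarrow> ('s \<times> 't \<Rightarrow>\<^sub>0 int) set monoid" where
  "tensor_group R M N = free_Abelian_group (carrier M \<times> carrier N) Mod tensor_kernel R M N"

definition simple_tensor :: "('r, 'e) ring_scheme \<Rightarrow> ('r, 's, 'm) module_scheme \<Rightarrow>
    ('r, 't, 'n) module_scheme \<Rightarrow> 's \<Rightarrow> 't \<Rightarrow> ('s \<times> 't \<Rightarrow>\<^sub>0 int) set" where
  "simple_tensor R M N m n =
     tensor_kernel R M N #>\<^bsub>free_Abelian_group (carrier M \<times> carrier N)\<^esub> frag_of (m, n)"

text \<open>
  The homomorphism of tensor products sending \<open>m \<otimes> n\<close> to \<open>p m \<otimes> q n\<close>, with \<open>R\<close>, \<open>M\<close>, \<open>N\<close> the data of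
  the target: push representatives forward and saturate with respect to the relations.
\<close>

definition tensor_map :: "('r, 'e) ring_scheme \<Rightarrow> ('r, 's, 'm) module_scheme \<Rightarrow>
    ('r, 't, 'n) module_scheme \<Rightarrow> ('u \<Rightarrow> 's) \<Rightarrow> ('v \<Rightarrow> 't) \<Rightarrow>
    ('u \<times> 'v \<Rightarrow>\<^sub>0 int) set \<Rightarrow> ('s \<times> 't \<Rightarrow>\<^sub>0 int) set" where
  "tensor_map R M N p q C = tensor_kernel R M N <#>\<^bsub>free_Abelian_group (carrier M \<times> carrier N)\<^esub>
     (frag_extend (\<lambda>(m, n). frag_of (p m, q n)) ` C)"

definition tensor_module :: "('r, 'e) ring_scheme \<Rightarrow> ('r, 's, 'm) module_scheme \<Rightarrow>
    ('r, 't, 'n) module_scheme \<Rightarrow> ('r, ('s \<times> 't \<Rightarrow>\<^sub>0 int) set) module" where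
  "tensor_module R M N = \<lparr>carrier = carrier (tensor_group R M N),
     mult = undefined, one = undefined,
     ring.zero = one (tensor_group R M N), add = monoid.mult (tensor_group R M N),
     smult = (\<lambda>r. tensor_map R M N (\<lambda>m. r \<odot>\<^bsub>M\<^esub> m) (\<lambda>n. n))\<rparr>"

definition tensor_presheaf :: "('p, 'r) ring_presheaf \<Rightarrow> ('p, 'r, 's) module_presheaf \<Rightarrow>
    ('p, 'r, 't) module_presheaf \<Rightarrow> ('p, 'r, ('s \<times> 't \<Rightarrow>\<^sub>0 int) set) module_presheaf" where
  "tensor_presheaf \<O> F G =
     \<lparr>sections = (\<lambda>U. tensor_module (sections \<O> U) (sections F U) (sections G U)),
      restr = (\<lambda>U V. tensor_map (sections \<O> V) (sections F V) (sections G V)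
        (restr F U V) (restr G U V))\<rparr>"

definition sheafification :: "'p topology \<Rightarrow> ('p, 'r) ring_presheaf \<Rightarrow> ('p, 'r, 's) module_presheaf \<Rightarrow>
    ('p, 'r, 'p \<Rightarrow> ('p set \<times> 's) set) module_presheaf" where
  "sheafification T \<O> F =
     \<lparr>sections = (\<lambda>U. \<lparr>carrier = {s \<in> extensional U. \<forall>x \<in> U. \<exists>V t.
           openin T V \<and> x \<in> V \<and> V \<subseteq> U \<and> t \<in> carrier (sections F V) \<and> (\<forall>y \<in> V. s y = germ T F y V t)},
        mult = undefined, one = undefined,
        ring.zero = (\<lambda>x \<in> U. germ T F x U \<zero>\<^bsub>sections F U\<^esub>),
        add = (\<lambda>s t. \<lambda>x \<in> U. stalk_add T F x (s x) (t x)),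
        smult = (\<lambda>a s. \<lambda>x \<in> U. \<Union>(V, t) \<in> s x. germ T F x (U \<inter> V)
           (restr \<O> U (U \<inter> V) a \<odot>\<^bsub>sections F (U \<inter> V)\<^esub> restr F V (U \<inter> V) t))\<rparr>),
      restr = (\<lambda>U V s. restrict s V)\<rparr>"

definition tensor_sheaf :: "'p topology \<Rightarrow> ('p, 'r) ring_presheaf \<Rightarrow> ('p, 'r, 's) module_presheaf \<Rightarrow>
    ('p, 'r, 't) module_presheaf \<Rightarrow>
    ('p, 'r, 'p \<Rightarrow> ('p set \<times> ('s \<times> 't \<Rightarrow>\<^sub>0 int) set) set) module_presheaf" where
  "tensor_sheaf T \<O> F G = sheafification T \<O> (tensor_presheaf \<O> F G)"

definition tensor_section :: "'p topology \<Rightarrow> ('p, 'r) ring_presheaf \<Rightarrow> ('p, 'r, 's) module_presheaf \<Rightarrow>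
    ('p, 'r, 't) module_presheaf \<Rightarrow> 'p set \<Rightarrow> 's \<Rightarrow> 't \<Rightarrow>
    'p \<Rightarrow> ('p set \<times> ('s \<times> 't \<Rightarrow>\<^sub>0 int) set) set" where
  "tensor_section T \<O> F G U s t = (\<lambda>x \<in> U. germ T (tensor_presheaf \<O> F G) x U
     (simple_tensor (sections \<O> U) (sections F U) (sections G U) s t))"


section \<open>Infinitesimal extensions\<close>

text \<open>
  The kernel of \<open>\<pi>\<close> is an \<open>\<O>\<^sub>Y\<close>-module because it is square-zero: \<open>\<pi> a\<close> acts as multiplication
  by \<open>a\<close>. The last assumption says that \<open>\<iota>\<close> is linear for this module structure.
\<close>

locale infinitesimal_extension = X: scheme T \<O>\<^sub>X
  for T :: "'p topology" and \<O>\<^sub>Y :: "('p, 'y) ring_presheaf" and F :: "('p, 'y, 'm) module_presheaf"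
    and \<O>\<^sub>X :: "('p, 'x) ring_presheaf" and \<pi> :: "'p set \<Rightarrow> 'x \<Rightarrow> 'y" and \<iota> :: "'p set \<Rightarrow> 'm \<Rightarrow> 'x" +
  assumes proj_hom: "ring_sheaf_hom T \<O>\<^sub>X \<O>\<^sub>Y \<pi>"
    and proj_surj: "\<lbrakk>openin T U; b \<in> carrier (sections \<O>\<^sub>Y U); x \<in> U\<rbrakk>
      \<Longrightarrow> \<exists>V. openin T V \<and> x \<in> V \<and> V \<subseteq> U \<and> restr \<O>\<^sub>Y U V b \<in> \<pi> V ` carrier (sections \<O>\<^sub>X V)"
    and square_zero: "\<lbrakk>openin T U; a \<in> a_kernel (sections \<O>\<^sub>X U) (sections \<O>\<^sub>Y U) (\<pi> U);
        a' \<in> a_kernel (sections \<O>\<^sub>X U) (sections \<O>\<^sub>Y U) (\<pi> U)\<rbrakk>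
      \<Longrightarrow> a \<otimes>\<^bsub>sections \<O>\<^sub>X U\<^esub> a' = \<zero>\<^bsub>sections \<O>\<^sub>X U\<^esub>"
    and incl_natural: "natural_map T F \<O>\<^sub>X \<iota>"
    and incl_bij: "openin T U \<Longrightarrow> bij_betw (\<iota> U) (carrier (sections F U))
        (a_kernel (sections \<O>\<^sub>X U) (sections \<O>\<^sub>Y U) (\<pi> U))"
    and incl_add: "\<lbrakk>openin T U; m \<in> carrier (sections F U); m' \<in> carrier (sections F U)\<rbrakk>
      \<Longrightarrow> \<iota> U (m \<oplus>\<^bsub>sections F U\<^esub> m') = \<iota> U m \<oplus>\<^bsub>sections \<O>\<^sub>X U\<^esub> \<iota> U m'"
    and incl_linear: "\<lbrakk>openin T U; a \<in> carrier (sections \<O>\<^sub>X U); m \<in> carrier (sections F U)\<rbrakk>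
      \<Longrightarrow> \<iota> U (\<pi> U a \<odot>\<^bsub>sections F U\<^esub> m) = a \<otimes>\<^bsub>sections \<O>\<^sub>X U\<^esub> \<iota> U m"

text \<open>Splitting of \<open>0 \<rightarrow> F \<rightarrow> \<O>\<^sub>X \<rightarrow> \<O>\<^sub>Y \<rightarrow> 0\<close> over \<open>\<O>\<^sub>Z\<close>, by a linear section of \<open>\<pi>\<close>.\<close>

definition split_extension :: "'p topology \<Rightarrow> ('p, 'z) ring_presheaf \<Rightarrow> ('p, 'z, 'x) module_presheaf \<Rightarrow>
    ('p, 'z, 'y) module_presheaf \<Rightarrow> ('p set \<Rightarrow> 'x \<Rightarrow> 'y) \<Rightarrow> bool" where
  "split_extension T \<O>\<^sub>Z E Q \<pi> \<longleftrightarrow> (\<exists>\<sigma>. module_sheaf_hom T \<O>\<^sub>Z Q E \<sigma> \<and>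
     (\<forall>U y. openin T U \<longrightarrow> y \<in> carrier (sections Q U) \<longrightarrow> \<pi> U (\<sigma> U y) = y))"

definition cocycle :: "('a, 'e) ring_scheme \<Rightarrow> ('a, 'm, 'n) module_scheme \<Rightarrow> ('a \<Rightarrow> 'a \<Rightarrow> 'm) \<Rightarrow> bool" where
  "cocycle A M b \<longleftrightarrow> (\<forall>r\<^sub>0 \<in> carrier A. \<forall>r\<^sub>1 \<in> carrier A. \<forall>r\<^sub>2 \<in> carrier A.
     (((r\<^sub>0 \<odot>\<^bsub>M\<^esub> b r\<^sub>1 r\<^sub>2) \<ominus>\<^bsub>M\<^esub> b (r\<^sub>0 \<otimes>\<^bsub>A\<^esub> r\<^sub>1) r\<^sub>2) \<oplus>\<^bsub>M\<^esub> b r\<^sub>0 (r\<^sub>1 \<otimes>\<^bsub>A\<^esub> r\<^sub>2)) \<ominus>\<^bsub>M\<^esub> (r\<^sub>2 \<odot>\<^bsub>M\<^esub> b r\<^sub>0 r\<^sub>1)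
       = \<zero>\<^bsub>M\<^esub>)"

definition symmetric_on :: "'a set \<Rightarrow> ('a \<Rightarrow> 'a \<Rightarrow> 'm) \<Rightarrow> bool" where
  "symmetric_on S b \<longleftrightarrow> (\<forall>r\<^sub>0 \<in> S. \<forall>r\<^sub>1 \<in> S. b r\<^sub>0 r\<^sub>1 = b r\<^sub>1 r\<^sub>0)"

definition twisted_ring :: "('a, 'e) ring_scheme \<Rightarrow> ('a, 'm, 'n) module_scheme \<Rightarrow> ('a \<Rightarrow> 'a \<Rightarrow> 'm) \<Rightarrow>
    ('a \<times> 'm) ring" where
  "twisted_ring A M b = \<lparr>carrier = carrier A \<times> carrier M,
     mult = (\<lambda>(x, m) (x', m'). (x \<otimes>\<^bsub>A\<^esub> x', ((x \<odot>\<^bsub>M\<^esub> m') \<oplus>\<^bsub>M\<^esub> (x' \<odot>\<^bsub>M\<^esub> m)) \<oplus>\<^bsub>M\<^esub> b x x')),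
     one = (\<one>\<^bsub>A\<^esub>, \<ominus>\<^bsub>M\<^esub> b \<one>\<^bsub>A\<^esub> \<one>\<^bsub>A\<^esub>),
     ring.zero = (\<zero>\<^bsub>A\<^esub>, \<zero>\<^bsub>M\<^esub>),
     add = (\<lambda>(x, m) (x', m'). (x \<oplus>\<^bsub>A\<^esub> x', m \<oplus>\<^bsub>M\<^esub> m'))\<rparr>"

text \<open>\<open>on_tensors T \<O>\<^sub>Z \<O>\<^sub>Y h f U r\<^sub>0 r\<^sub>1\<close> is \<open>f(r\<^sub>0, r\<^sub>1) = f(r\<^sub>0 \<otimes> r\<^sub>1)\<close> over \<open>U\<close>.\<close>

definition on_tensors :: "'p topology \<Rightarrow> ('p, 'z) ring_presheaf \<Rightarrow> ('p, 'y) ring_presheaf \<Rightarrow>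
    ('p set \<Rightarrow> 'z \<Rightarrow> 'y) \<Rightarrow>
    ('p set \<Rightarrow> ('p \<Rightarrow> ('p set \<times> ('y \<times> 'y \<Rightarrow>\<^sub>0 int) set) set) \<Rightarrow> 'm) \<Rightarrow> 'p set \<Rightarrow> 'y \<Rightarrow> 'y \<Rightarrow> 'm" where
  "on_tensors T \<O>\<^sub>Z \<O>\<^sub>Y h f U r\<^sub>0 r\<^sub>1 =
     f U (tensor_section T \<O>\<^sub>Z (algebra_sheaf h \<O>\<^sub>Y) (algebra_sheaf h \<O>\<^sub>Y) U r\<^sub>0 r\<^sub>1)"

end

theory Submission
  imports Defs
begin

text \<open>
  Let \<open>\<sigma>\<close> be the \<open>\<O>\<^sub>Z\<close>-linear section of \<open>\<pi>\<close>. Then \<open>\<Phi> (x, m) = \<sigma> x + \<iota> m\<close> is the required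
  isomorphism, and the failure \<open>\<sigma> x \<sigma> y - \<sigma> (x y)\<close> of \<open>\<sigma>\<close> to be multiplicative lies in the kernel of
  \<open>\<pi>\<close>, so it is \<open>\<iota> (f (x, y))\<close> for a unique \<open>f (x, y)\<close>. Bilinearity over \<open>\<O>\<^sub>Z\<close>, symmetry and the
  cocycle identity are ring identities in \<open>\<O>\<^sub>X\<close>, because \<open>\<iota>\<close> is injective and \<open>x\<close> acts on the kernel
  as multiplication by \<open>\<sigma> x\<close>. The bilinear maps on sections induce a map of presheaves on the
  presheaf tensor product, and this extends uniquely to the sheafification since \<open>F\<close> is a sheaf.
\<close>

section \<open>Maps out of tensor products\<close>

text \<open>The section \<open>\<sigma>\<close> makes \<open>\<pi>\<close> surjective on sections
  over every open set and not just locally, so the ring-theoretic work is done one open set at a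
  time, with the kernel of a single ring homomorphism. Sheaf theory enters through the source of f:
  a section of the tensor product sheaf is a family of germs and need not be a finite sum of
  tensors, so f cannot simply be prescribed on generators over an open set. Two universal properties
  are applied in succession, and the value on a tensor is carried back through both. For this f the
  ring axioms of the twisted product are transported from \<open>\<O>\<^sub>X\<close> along
  \<open>\<Phi>\<close>. That condition 1 yields associativity and the unit, and condition 2
  commutativity, is a claim about an arbitrary f, with no extension ring to compare with; it is
  checked directly on pairs.\<close>

abbreviation frag_pair_map :: "('u \<Rightarrow> 's) \<Rightarrow> ('v \<Rightarrow> 't) \<Rightarrow> ('u \<times> 'v \<Rightarrow>\<^sub>0 int) \<Rightarrow> ('s \<times> 't \<Rightarrow>\<^sub>0 int)" where
  "frag_pair_map p q \<equiv> frag_extend (\<lambda>(m, n). frag_of (p m, q n))"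

text \<open>Members of the free abelian group on a set are the finitely supported functions with
  keys in that set, so this bound is what places the pushforward in the target group.\<close>

lemma keys_frag_pair_map:
  assumes "p \<in> S \<rightarrow> S'" "q \<in> T \<rightarrow> T'" "Poly_Mapping.keys c \<subseteq> S \<times> T"
  shows "Poly_Mapping.keys (frag_pair_map p q c) \<subseteq> S' \<times> T'"
proof -
  have "Poly_Mapping.keys (frag_pair_map p q c)
      \<subseteq> (\<Union>x \<in> Poly_Mapping.keys c. Poly_Mapping.keys ((\<lambda>(m, n). frag_of (p m, q n)) x))"
    by (rule keys_frag_extend)
  also have "\<dots> \<subseteq> S' \<times> T'"
    using assms by (force simp: Pi_iff)
  finally show ?thesis .
qed

lemma frag_pair_map_hom:
  assumes "p \<in> S \<rightarrow> S'" "q \<in> T \<rightarrow> T'"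
  shows "frag_pair_map p q \<in> hom (free_Abelian_group (S \<times> T)) (free_Abelian_group (S' \<times> T'))"
  using keys_frag_pair_map[OF assms] by (auto simp: hom_def frag_extend_add)

section \<open>The tensor product of modules as a quotient of a free abelian group\<close>

locale module_pair = M: Module.module R M + N: Module.module R N
  for R :: "('r, 'e) ring_scheme" (structure) and M :: "('r, 's, 'm) module_scheme"
    and N :: "('r, 't, 'n) module_scheme"
begin

abbreviation "FG \<equiv> free_Abelian_group (carrier M \<times> carrier N)"
abbreviation "K \<equiv> tensor_kernel R M N"

lemma tensor_relations_carrier: "tensor_relations R M N \<subseteq> carrier FG"
  unfolding tensor_relations_def by (auto dest!: subsetD[OF keys_diff])

lemma tensor_kernel_subgroup: "subgroup K FG"
  unfolding tensor_kernel_def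
  by (rule group.generate_is_subgroup[OF group_free_Abelian_group tensor_relations_carrier])

lemma tensor_kernel_normal: "K \<lhd> FG"
  by (rule comm_group.subgroup_imp_normal[OF abelian_free_Abelian_group tensor_kernel_subgroup])

lemma tensor_kernel_zero: "0 \<in> K"
  using subgroup.one_closed[OF tensor_kernel_subgroup] by simp

lemma tensor_kernel_add: "k \<in> K \<Longrightarrow> k' \<in> K \<Longrightarrow> k + k' \<in> K"
  using subgroup.m_closed[OF tensor_kernel_subgroup, of k k'] by simp

lemma tensor_kernel_keys: "k \<in> K \<Longrightarrow> Poly_Mapping.keys k \<subseteq> carrier M \<times> carrier N"
  using subgroup.mem_carrier[OF tensor_kernel_subgroup] by simp

lemma tensor_coset_eq: "K #>\<^bsub>FG\<^esub> c = {k + c | k. k \<in> K}"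
  by (auto simp: r_coset_def)

lemma tensor_module_elems:
  "C \<in> carrier (tensor_module R M N) \<longleftrightarrow>
   (\<exists>c. Poly_Mapping.keys c \<subseteq> carrier M \<times> carrier N \<and> C = K #>\<^bsub>FG\<^esub> c)"
  by (simp add: tensor_module_def tensor_group_def carrier_FactGroup image_iff Bex_def)

lemma tensor_cosetI:
  "Poly_Mapping.keys c \<subseteq> carrier M \<times> carrier N \<Longrightarrow> K #>\<^bsub>FG\<^esub> c \<in> carrier (tensor_module R M N)"
  using tensor_module_elems by blast

lemma tensor_cosetE:
  assumes "C \<in> carrier (tensor_module R M N)"
  obtains c where "Poly_Mapping.keys c \<subseteq> carrier M \<times> carrier N" "C = K #>\<^bsub>FG\<^esub> c"
  using assms tensor_module_elems by blast

lemma tensor_coset_add: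
  assumes "Poly_Mapping.keys c \<subseteq> carrier M \<times> carrier N" "Poly_Mapping.keys d \<subseteq> carrier M \<times> carrier N"
  shows "(K #>\<^bsub>FG\<^esub> c) \<oplus>\<^bsub>tensor_module R M N\<^esub> (K #>\<^bsub>FG\<^esub> d) = K #>\<^bsub>FG\<^esub> (c + d)"
  using normal.rcos_sum[OF tensor_kernel_normal, of c d] assms
  by (simp add: tensor_module_def tensor_group_def)

lemma tensor_add_closed:
  assumes "C \<in> carrier (tensor_module R M N)" "D \<in> carrier (tensor_module R M N)"
  shows "C \<oplus>\<^bsub>tensor_module R M N\<^esub> D \<in> carrier (tensor_module R M N)"
proof -
  obtain c d where c: "Poly_Mapping.keys c \<subseteq> carrier M \<times> carrier N" "C = K #>\<^bsub>FG\<^esub> c"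
    and d: "Poly_Mapping.keys d \<subseteq> carrier M \<times> carrier N" "D = K #>\<^bsub>FG\<^esub> d"
    using assms by (auto elim!: tensor_cosetE)
  have "Poly_Mapping.keys (c + d) \<subseteq> carrier M \<times> carrier N"
    using keys_add[of c d] c d by blast
  then show ?thesis
    using c d by (simp add: tensor_coset_add tensor_cosetI)
qed

lemma simple_tensor_closed:
  "\<lbrakk>m \<in> carrier M; n \<in> carrier N\<rbrakk> \<Longrightarrow> simple_tensor R M N m n \<in> carrier (tensor_module R M N)"
  unfolding simple_tensor_def by (rule tensor_cosetI) simp

end

section \<open>Functoriality of the tensor product\<close>

text \<open>The maps are semilinear over \<open>\<rho>\<close> because restriction from U to V also
  changes the ring of scalars. With \<open>\<rho>\<close> the identity the same locale covers
  multiplication by a fixed scalar.\<close>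

locale module_pair_map = source: module_pair R M N + target: module_pair R' M' N'
  for R :: "('r, 'e) ring_scheme" and M :: "('r, 's, 'm) module_scheme"
    and N :: "('r, 't, 'n) module_scheme"
    and R' :: "('r2, 'e2) ring_scheme" and M' :: "('r2, 's2, 'm2) module_scheme"
    and N' :: "('r2, 't2, 'n2) module_scheme" +
  fixes \<rho> :: "'r \<Rightarrow> 'r2" and p :: "'s \<Rightarrow> 's2" and q :: "'t \<Rightarrow> 't2"
  assumes scalar_closed: "r \<in> carrier R \<Longrightarrow> \<rho> r \<in> carrier R'"
    and p_closed: "m \<in> carrier M \<Longrightarrow> p m \<in> carrier M'"
    and p_add: "\<lbrakk>m \<in> carrier M; m' \<in> carrier M\<rbrakk> \<Longrightarrow> p (m \<oplus>\<^bsub>M\<^esub> m') = p m \<oplus>\<^bsub>M'\<^esub> p m'"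
    and p_smult: "\<lbrakk>r \<in> carrier R; m \<in> carrier M\<rbrakk> \<Longrightarrow> p (r \<odot>\<^bsub>M\<^esub> m) = \<rho> r \<odot>\<^bsub>M'\<^esub> p m"
    and q_closed: "n \<in> carrier N \<Longrightarrow> q n \<in> carrier N'"
    and q_add: "\<lbrakk>n \<in> carrier N; n' \<in> carrier N\<rbrakk> \<Longrightarrow> q (n \<oplus>\<^bsub>N\<^esub> n') = q n \<oplus>\<^bsub>N'\<^esub> q n'"
    and q_smult: "\<lbrakk>r \<in> carrier R; n \<in> carrier N\<rbrakk> \<Longrightarrow> q (r \<odot>\<^bsub>N\<^esub> n) = \<rho> r \<odot>\<^bsub>N'\<^esub> q n"
begin

text \<open>Semilinearity carries each of the three kinds of relation to a relation of the same
  kind, so no subgroup has to be generated at this stage.\<close>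

lemma frag_pair_map_relations:
  "frag_pair_map p q ` tensor_relations R M N \<subseteq> tensor_relations R' M' N'"
proof (rule image_subsetI)
  fix x assume "x \<in> tensor_relations R M N"
  then consider
    (left) m m' n where "x = frag_of (m \<oplus>\<^bsub>M\<^esub> m', n) - frag_of (m, n) - frag_of (m', n)"
      "m \<in> carrier M" "m' \<in> carrier M" "n \<in> carrier N"
    | (right) m n n' where "x = frag_of (m, n \<oplus>\<^bsub>N\<^esub> n') - frag_of (m, n) - frag_of (m, n')"
      "m \<in> carrier M" "n \<in> carrier N" "n' \<in> carrier N"
    | (scalar) r m n where "x = frag_of (r \<odot>\<^bsub>M\<^esub> m, n) - frag_of (m, r \<odot>\<^bsub>N\<^esub> n)"
      "r \<in> carrier R" "m \<in> carrier M" "n \<in> carrier N"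
    unfolding tensor_relations_def by blast
  then show "frag_pair_map p q x \<in> tensor_relations R' M' N'"
  proof cases
    case left
    then have "frag_pair_map p q x
        = frag_of (p m \<oplus>\<^bsub>M'\<^esub> p m', q n) - frag_of (p m, q n) - frag_of (p m', q n)"
      by (simp add: frag_extend_diff p_add)
    then show ?thesis
      unfolding tensor_relations_def using left p_closed q_closed by blast
  next
    case right
    then have "frag_pair_map p q x
        = frag_of (p m, q n \<oplus>\<^bsub>N'\<^esub> q n') - frag_of (p m, q n) - frag_of (p m, q n')"
      by (simp add: frag_extend_diff q_add)
    then show ?thesis
      unfolding tensor_relations_def using right p_closed q_closed by blast
  next
    case scalar
    then have "frag_pair_map p q x
        = frag_of (\<rho> r \<odot>\<^bsub>M'\<^esub> p m, q n) - frag_of (p m, \<rho> r \<odot>\<^bsub>N'\<^esub> q n)"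
      by (simp add: frag_extend_diff p_smult q_smult)
    then show ?thesis
      unfolding tensor_relations_def using scalar p_closed q_closed scalar_closed by blast
  qed
qed

text \<open>A homomorphism maps the subgroup generated by a set onto the subgroup generated by its
  image.\<close>

lemma frag_pair_map_kernel: "k \<in> source.K \<Longrightarrow> frag_pair_map p q k \<in> target.K"
proof -
  assume k: "k \<in> source.K"
  interpret FF: group_hom source.FG target.FG "frag_pair_map p q"
    using frag_pair_map_hom[of p "carrier M" "carrier M'" q "carrier N" "carrier N'"] p_closed q_closed
    by (auto simp: group_hom_def group_hom_axioms_def)
  have "frag_pair_map p q ` source.K = generate target.FG (frag_pair_map p q ` tensor_relations R M N)"
    unfolding tensor_kernel_def by (rule FF.generate_img[OF source.tensor_relations_carrier, symmetric])
  also have "\<dots> \<subseteq> target.K"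
    unfolding tensor_kernel_def by (rule FF.mono_generate[OF frag_pair_map_relations])
  finally show ?thesis using k by blast
qed

text \<open>Pushing forward a whole coset adds only images of kernel elements, and the saturation in
  \<open>tensor_map\<close> absorbs them. Hence \<open>tensor_map\<close> can be computed on any
  representative.\<close>

lemma tensor_map_coset:
  assumes "Poly_Mapping.keys c \<subseteq> carrier M \<times> carrier N"
  shows "tensor_map R' M' N' p q (source.K #>\<^bsub>source.FG\<^esub> c) = target.K #>\<^bsub>target.FG\<^esub> frag_pair_map p q c"
proof -
  have "tensor_map R' M' N' p q (source.K #>\<^bsub>source.FG\<^esub> c)
      = {k' + (frag_pair_map p q k + frag_pair_map p q c) | k' k. k' \<in> target.K \<and> k \<in> source.K}"
    by (force simp: tensor_map_def set_mult_def source.tensor_coset_eq frag_extend_add)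
  also have "\<dots> = {k + frag_pair_map p q c | k. k \<in> target.K}"
  proof (intro subset_antisym subsetI)
    fix x assume "x \<in> {k' + (frag_pair_map p q k + frag_pair_map p q c) | k' k. k' \<in> target.K \<and> k \<in> source.K}"
    then obtain k' k where x: "x = k' + (frag_pair_map p q k + frag_pair_map p q c)"
      and k: "k' \<in> target.K" "k \<in> source.K"
      by blast
    have "x = (k' + frag_pair_map p q k) + frag_pair_map p q c" by (simp add: x add.assoc)
    moreover have "k' + frag_pair_map p q k \<in> target.K"
      by (intro target.tensor_kernel_add frag_pair_map_kernel k)
    ultimately show "x \<in> {k + frag_pair_map p q c | k. k \<in> target.K}" by blast
  next
    fix x assume "x \<in> {k + frag_pair_map p q c | k. k \<in> target.K}"
    \<comment> \<open>The representative \<open>c\<close> itself, that is \<open>k = 0\<close>,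
      already produces the full target coset.\<close>
    then obtain k' where "x = k' + (frag_pair_map p q 0 + frag_pair_map p q c)" "k' \<in> target.K"
      by auto
    then show "x \<in> {k' + (frag_pair_map p q k + frag_pair_map p q c) | k' k. k' \<in> target.K \<and> k \<in> source.K}"
      using source.tensor_kernel_zero by blast
  qed
  finally show ?thesis by (simp add: target.tensor_coset_eq)
qed

lemma frag_pair_map_keys:
  "Poly_Mapping.keys c \<subseteq> carrier M \<times> carrier N
   \<Longrightarrow> Poly_Mapping.keys (frag_pair_map p q c) \<subseteq> carrier M' \<times> carrier N'"
  by (rule keys_frag_pair_map) (auto simp: p_closed q_closed)

lemma tensor_map_closed:
  "C \<in> carrier (tensor_module R M N) \<Longrightarrow> tensor_map R' M' N' p q C \<in> carrier (tensor_module R' M' N')"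
  by (erule source.tensor_cosetE) (simp add: tensor_map_coset target.tensor_cosetI frag_pair_map_keys)

end

text \<open>Scalar multiplication on the tensor product is itself a \<open>tensor_map\<close>, so
  its properties are instances of functoriality. Commutativity of the ring makes scaling the left
  factor linear.\<close>

lemma (in module_pair) smult_module_pair_map:
  assumes "r \<in> carrier R"
  shows "module_pair_map R M N R M N (\<lambda>a. a) (\<lambda>m. r \<odot>\<^bsub>M\<^esub> m) (\<lambda>n. n)"
proof -
  have comm: "r \<odot>\<^bsub>M\<^esub> (a \<odot>\<^bsub>M\<^esub> m) = a \<odot>\<^bsub>M\<^esub> (r \<odot>\<^bsub>M\<^esub> m)" if "a \<in> carrier R" "m \<in> carrier M" for a m
    using assms that by (simp add: M.smult_assoc1[symmetric] M.R.m_comm)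
  show ?thesis
    by (intro module_pair_map.intro module_pair_map_axioms.intro module_pair_axioms comm)
      (simp_all add: assms M.smult_r_distr)
qed

lemma (in module_pair) tensor_smult_closed:
  "\<lbrakk>r \<in> carrier R; C \<in> carrier (tensor_module R M N)\<rbrakk>
   \<Longrightarrow> r \<odot>\<^bsub>tensor_module R M N\<^esub> C \<in> carrier (tensor_module R M N)"
  using module_pair_map.tensor_map_closed[OF smult_module_pair_map, of r C]
  by (simp add: tensor_module_def[of R M N])

section \<open>The universal property of the tensor product\<close>

text \<open>A choice of the homomorphism supplied by the universal property of the free abelian
  group; it exists as soon as \<open>b\<close> maps into the carrier of \<open>G\<close>.\<close>

definition frag_lift :: "('r, 's, 'm) module_scheme \<Rightarrow> ('r, 't, 'n) module_scheme \<Rightarrow>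
    ('r, 'g, 'l) module_scheme \<Rightarrow> ('s \<Rightarrow> 't \<Rightarrow> 'g) \<Rightarrow> ('s \<times> 't \<Rightarrow>\<^sub>0 int) \<Rightarrow> 'g" where
  "frag_lift M N G b = (SOME H. H \<in> hom (free_Abelian_group (carrier M \<times> carrier N)) (add_monoid G) \<and>
     (\<forall>m \<in> carrier M. \<forall>n \<in> carrier N. H (frag_of (m, n)) = b m n))"

text \<open>Evaluation at an arbitrary representative of the coset; \<open>tensor_lift_coset\<close>
  shows that the choice does not matter when \<open>b\<close> is bilinear.\<close>

definition tensor_lift :: "('r, 's, 'm) module_scheme \<Rightarrow> ('r, 't, 'n) module_scheme \<Rightarrow>
    ('r, 'g, 'l) module_scheme \<Rightarrow> ('s \<Rightarrow> 't \<Rightarrow> 'g) \<Rightarrow> ('s \<times> 't \<Rightarrow>\<^sub>0 int) set \<Rightarrow> 'g" where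
  "tensor_lift M N G b C = frag_lift M N G b (SOME c. c \<in> C)"

text \<open>\<open>smult_left\<close> and \<open>smult_right\<close> together kill the third kind of
  relation. \<open>smult_left\<close> also makes the induced map linear, because scalars act on a
  tensor through its left factor.\<close>

locale bilinear_map = module_pair R M N + G: Module.module R G
  for R :: "('r, 'e) ring_scheme" (structure) and M :: "('r, 's, 'm) module_scheme"
    and N :: "('r, 't, 'n) module_scheme" and G :: "('r, 'g, 'l) module_scheme" +
  fixes b :: "'s \<Rightarrow> 't \<Rightarrow> 'g"
  assumes closed: "\<lbrakk>m \<in> carrier M; n \<in> carrier N\<rbrakk> \<Longrightarrow> b m n \<in> carrier G"
    and add_left: "\<lbrakk>m \<in> carrier M; m' \<in> carrier M; n \<in> carrier N\<rbrakk>
      \<Longrightarrow> b (m \<oplus>\<^bsub>M\<^esub> m') n = b m n \<oplus>\<^bsub>G\<^esub> b m' n"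
    and add_right: "\<lbrakk>m \<in> carrier M; n \<in> carrier N; n' \<in> carrier N\<rbrakk>
      \<Longrightarrow> b m (n \<oplus>\<^bsub>N\<^esub> n') = b m n \<oplus>\<^bsub>G\<^esub> b m n'"
    and smult_left: "\<lbrakk>r \<in> carrier R; m \<in> carrier M; n \<in> carrier N\<rbrakk>
      \<Longrightarrow> b (r \<odot>\<^bsub>M\<^esub> m) n = r \<odot>\<^bsub>G\<^esub> b m n"
    and smult_right: "\<lbrakk>r \<in> carrier R; m \<in> carrier M; n \<in> carrier N\<rbrakk>
      \<Longrightarrow> b m (r \<odot>\<^bsub>N\<^esub> n) = r \<odot>\<^bsub>G\<^esub> b m n"
begin

abbreviation "H \<equiv> frag_lift M N G b"
abbreviation "L \<equiv> tensor_lift M N G b"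

lemma frag_lift_props:
  "H \<in> hom FG (add_monoid G) \<and> (\<forall>m \<in> carrier M. \<forall>n \<in> carrier N. H (frag_of (m, n)) = b m n)"
proof -
  have "(\<lambda>(m, n). b m n) ` (carrier M \<times> carrier N) \<subseteq> carrier (add_monoid G)"
    using closed by auto
  from comm_group.free_Abelian_group_universal[OF G.a_comm_group this]
  obtain f where "f \<in> hom FG (add_monoid G)"
    "\<And>x. x \<in> carrier M \<times> carrier N \<Longrightarrow> f (frag_of x) = (\<lambda>(m, n). b m n) x"
    by blast
  then have "\<exists>f. f \<in> hom FG (add_monoid G) \<and> (\<forall>m \<in> carrier M. \<forall>n \<in> carrier N. f (frag_of (m, n)) = b m n)"
    by (intro exI[of _ f]) auto
  then show ?thesis
    unfolding frag_lift_def by (rule someI_ex)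
qed

sublocale H: group_hom FG "add_monoid G" H
  using frag_lift_props G.a_group by (auto simp: group_hom_def group_hom_axioms_def)

lemma frag_lift_of: "\<lbrakk>m \<in> carrier M; n \<in> carrier N\<rbrakk> \<Longrightarrow> H (frag_of (m, n)) = b m n"
  using frag_lift_props by blast

lemma frag_lift_closed:
  "Poly_Mapping.keys c \<subseteq> carrier M \<times> carrier N \<Longrightarrow> H c \<in> carrier G"
  using H.hom_closed[of c] by simp

lemma frag_lift_add:
  "\<lbrakk>Poly_Mapping.keys c \<subseteq> carrier M \<times> carrier N; Poly_Mapping.keys d \<subseteq> carrier M \<times> carrier N\<rbrakk>
   \<Longrightarrow> H (c + d) = H c \<oplus>\<^bsub>G\<^esub> H d"
  using H.hom_mult[of c d] by simp

lemma frag_lift_zero: "H 0 = \<zero>\<^bsub>G\<^esub>"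
  using H.hom_one by simp

lemma frag_lift_diff:
  assumes "Poly_Mapping.keys c \<subseteq> carrier M \<times> carrier N" "Poly_Mapping.keys d \<subseteq> carrier M \<times> carrier N"
  shows "H (c - d) = H c \<ominus>\<^bsub>G\<^esub> H d"
proof -
  have "H (c + (- d)) = H c \<oplus>\<^bsub>G\<^esub> H (- d)"
    using assms by (intro frag_lift_add) auto
  moreover have "H (- d) = \<ominus>\<^bsub>G\<^esub> H d"
    using H.hom_inv[of d] assms by (simp add: a_inv_def)
  ultimately show ?thesis by (simp add: a_minus_def)
qed

lemma frag_lift_relation:
  assumes "x \<in> tensor_relations R M N"
  shows "H x = \<zero>\<^bsub>G\<^esub>"
proof -
  have *: "Poly_Mapping.keys (frag_of x - frag_of y) \<subseteq> S" if "x \<in> S" "y \<in> S" for x y S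
    using keys_diff[of "frag_of x" "frag_of y"] that by auto
  have G: "(u \<oplus>\<^bsub>G\<^esub> v) \<ominus>\<^bsub>G\<^esub> u \<ominus>\<^bsub>G\<^esub> v = \<zero>\<^bsub>G\<^esub>" if "u \<in> carrier G" "v \<in> carrier G" for u v
  proof -
    have "(u \<oplus>\<^bsub>G\<^esub> v) \<ominus>\<^bsub>G\<^esub> u \<ominus>\<^bsub>G\<^esub> v = (u \<oplus>\<^bsub>G\<^esub> v) \<oplus>\<^bsub>G\<^esub> \<ominus>\<^bsub>G\<^esub> (u \<oplus>\<^bsub>G\<^esub> v)"
      using that by (simp add: a_minus_def G.M.a_assoc G.M.minus_add)
    then show ?thesis using that by (simp add: G.M.r_neg)
  qed
  have G': "u \<ominus>\<^bsub>G\<^esub> u = \<zero>\<^bsub>G\<^esub>" if "u \<in> carrier G" for u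
    using that by (simp add: a_minus_def G.M.r_neg)
  show ?thesis
    using assms unfolding tensor_relations_def
    by (auto simp: frag_lift_diff * frag_lift_of add_left add_right smult_left smult_right closed G G')
qed

text \<open>The kernel of \<open>H\<close> is a subgroup, so it is enough that it contains the
  generating relations.\<close>

lemma frag_lift_kernel:
  assumes "k \<in> K"
  shows "H k = \<zero>\<^bsub>G\<^esub>"
proof -
  have "tensor_relations R M N \<subseteq> kernel FG (add_monoid G) H"
    using frag_lift_relation tensor_relations_carrier
    by (auto simp: kernel_def simp del: carrier_free_Abelian_group_iff)
  then have "K \<subseteq> kernel FG (add_monoid G) H"
    unfolding tensor_kernel_def
    by (rule group.generate_subgroup_incl[OF group_free_Abelian_group _ H.subgroup_kernel])
  then show ?thesis using assms by (auto simp: kernel_def)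
qed

text \<open>The chosen representative differs from \<open>c\<close> by an element of
  \<open>K\<close>, and \<open>H\<close> vanishes there.\<close>

lemma tensor_lift_coset:
  assumes "Poly_Mapping.keys c \<subseteq> carrier M \<times> carrier N"
  shows "L (K #>\<^bsub>FG\<^esub> c) = H c"
proof -
  have "0 + c \<in> K #>\<^bsub>FG\<^esub> c"
    using tensor_kernel_zero by (auto simp: tensor_coset_eq)
  then have "(SOME d. d \<in> K #>\<^bsub>FG\<^esub> c) \<in> K #>\<^bsub>FG\<^esub> c"
    by (rule someI)
  then obtain k where k: "k \<in> K" "(SOME d. d \<in> K #>\<^bsub>FG\<^esub> c) = k + c"
    by (auto simp: tensor_coset_eq)
  then have "L (K #>\<^bsub>FG\<^esub> c) = H (k + c)"
    by (simp add: tensor_lift_def)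
  also have "\<dots> = H c"
    using k assms by (simp add: frag_lift_add tensor_kernel_keys frag_lift_kernel frag_lift_closed)
  finally show ?thesis .
qed

lemma tensor_lift_simple:
  "\<lbrakk>m \<in> carrier M; n \<in> carrier N\<rbrakk> \<Longrightarrow> L (simple_tensor R M N m n) = b m n"
  by (simp add: simple_tensor_def tensor_lift_coset frag_lift_of)

lemma tensor_lift_closed: "C \<in> carrier (tensor_module R M N) \<Longrightarrow> L C \<in> carrier G"
  by (erule tensor_cosetE) (simp add: tensor_lift_coset frag_lift_closed)

lemma tensor_lift_add:
  assumes "C \<in> carrier (tensor_module R M N)" "D \<in> carrier (tensor_module R M N)"
  shows "L (C \<oplus>\<^bsub>tensor_module R M N\<^esub> D) = L C \<oplus>\<^bsub>G\<^esub> L D"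
proof -
  obtain c d where c: "Poly_Mapping.keys c \<subseteq> carrier M \<times> carrier N" "C = K #>\<^bsub>FG\<^esub> c"
    and d: "Poly_Mapping.keys d \<subseteq> carrier M \<times> carrier N" "D = K #>\<^bsub>FG\<^esub> d"
    using assms by (auto elim!: tensor_cosetE)
  have "Poly_Mapping.keys (c + d) \<subseteq> carrier M \<times> carrier N"
    using keys_add[of c d] c d by blast
  then show ?thesis
    using c d by (simp add: tensor_coset_add tensor_lift_coset frag_lift_add)
qed

end

text \<open>Both sides come from additive maps on the free abelian group that agree on its
  generators. \<open>\<theta>\<close> is only asked to be additive, since the two target modules may
  lie over different rings. The lemma serves for restriction maps and for multiplication by a
  scalar.\<close>

lemma tensor_lift_natural:
  fixes \<theta> :: "'g \<Rightarrow> 'g2"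
  assumes B: "bilinear_map R M N G b" and B': "bilinear_map R' M' N' G' b'"
    and P: "module_pair_map R M N R' M' N' \<rho> p q"
    and \<theta>: "\<And>u. u \<in> carrier G \<Longrightarrow> \<theta> u \<in> carrier G'"
      "\<And>u v. u \<in> carrier G \<Longrightarrow> v \<in> carrier G \<Longrightarrow> \<theta> (u \<oplus>\<^bsub>G\<^esub> v) = \<theta> u \<oplus>\<^bsub>G'\<^esub> \<theta> v"
    and nat: "\<And>m n. m \<in> carrier M \<Longrightarrow> n \<in> carrier N \<Longrightarrow> b' (p m) (q n) = \<theta> (b m n)"
    and C: "C \<in> carrier (tensor_module R M N)"
  shows "tensor_lift M' N' G' b' (tensor_map R' M' N' p q C) = \<theta> (tensor_lift M N G b C)"
proof -
  interpret B: bilinear_map R M N G b by (rule B)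
  interpret B': bilinear_map R' M' N' G' b' by (rule B')
  interpret P: module_pair_map R M N R' M' N' \<rho> p q by (rule P)
  interpret T: abelian_group_hom G G' \<theta>
    using \<theta> by (intro abelian_group_homI B.G.abelian_group_axioms B'.G.abelian_group_axioms)
      (auto simp: group_hom_def group_hom_axioms_def hom_def B.G.a_group B'.G.a_group)
  have eq: "B'.H (frag_pair_map p q c) = \<theta> (B.H c)"
    if "Poly_Mapping.keys c \<subseteq> carrier M \<times> carrier N" for c
    using that
  proof (rule free_Abelian_group_induct)
    show "B'.H (frag_pair_map p q 0) = \<theta> (B.H 0)"
      by (simp add: B.frag_lift_zero B'.frag_lift_zero T.hom_zero)
  next
    fix x y
    assume xy: "Poly_Mapping.keys x \<subseteq> carrier M \<times> carrier N"
      "Poly_Mapping.keys y \<subseteq> carrier M \<times> carrier N"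
      and "B'.H (frag_pair_map p q x) = \<theta> (B.H x)" "B'.H (frag_pair_map p q y) = \<theta> (B.H y)"
    then show "B'.H (frag_pair_map p q (x - y)) = \<theta> (B.H (x - y))"
      by (simp add: frag_extend_diff B'.frag_lift_diff P.frag_pair_map_keys B.frag_lift_diff
          B.frag_lift_closed a_minus_def)
  next
    fix a assume "a \<in> carrier M \<times> carrier N"
    then show "B'.H (frag_pair_map p q (frag_of a)) = \<theta> (B.H (frag_of a))"
      by (auto simp: B.frag_lift_of B'.frag_lift_of P.p_closed P.q_closed nat)
  qed
  obtain c where "Poly_Mapping.keys c \<subseteq> carrier M \<times> carrier N" "C = B.K #>\<^bsub>B.FG\<^esub> c"
    using C by (rule B.tensor_cosetE)
  then show ?thesis
    by (simp add: P.tensor_map_coset B'.tensor_lift_coset B.tensor_lift_coset P.frag_pair_map_keys eq)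
qed

text \<open>Linearity is naturality with respect to scaling: \<open>p\<close> scales the left factor
  and \<open>\<theta>\<close> scales the target.\<close>

lemma (in bilinear_map) tensor_lift_smult:
  assumes "r \<in> carrier R" "C \<in> carrier (tensor_module R M N)"
  shows "L (r \<odot>\<^bsub>tensor_module R M N\<^esub> C) = r \<odot>\<^bsub>G\<^esub> L C"
proof -
  have "L (tensor_map R M N (\<lambda>m. r \<odot>\<^bsub>M\<^esub> m) (\<lambda>n. n) C) = r \<odot>\<^bsub>G\<^esub> L C"
    using assms
    by (intro tensor_lift_natural[OF bilinear_map_axioms bilinear_map_axioms smult_module_pair_map])
      (auto simp: G.smult_r_distr smult_left)
  then show ?thesis by (simp add: tensor_module_def)
qed


section \<open>Maps out of sheafifications\<close>

lemma germ_self: "\<lbrakk>openin T V; x \<in> V; c \<in> carrier (sections P V)\<rbrakk> \<Longrightarrow> (V, c) \<in> germ T P x V c"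
  unfolding germ_def by blast

lemma (in sheaf) restr_eq_mono:
  assumes "restr F U W s = restr F V W t" "openin T U" "openin T V" "openin T W" "openin T W'"
    "W' \<subseteq> W" "W \<subseteq> U" "W \<subseteq> V" "s \<in> carrier (sections F U)" "t \<in> carrier (sections F V)"
  shows "restr F U W' s = restr F V W' t"
  using restr_comp[of U W W' s] restr_comp[of V W W' t] assms by simp

lemma (in sheaf) eq_if_locally_eq:
  assumes U: "openin T U" and s: "s \<in> carrier (sections F U)" and t: "t \<in> carrier (sections F U)"
    and loc: "\<And>x. x \<in> U \<Longrightarrow> \<exists>W. openin T W \<and> x \<in> W \<and> W \<subseteq> U \<and> restr F U W s = restr F U W t"
  shows "s = t"
proof -
  \<comment> \<open>The cover consists of all open sets on which \<open>s\<close> and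
    \<open>t\<close> already agree.\<close>
  let ?C = "{W. openin T W \<and> W \<subseteq> U \<and> restr F U W s = restr F U W t}"
  have "\<Union>?C = U" using loc by blast
  then show ?thesis
    using locality[of ?C s t] s t by auto
qed

text \<open>
  All representatives of \<open>s x\<close> are tested, so that additivity and linearity of the map defined
  below can be checked without showing that the stalk operations are well defined.
\<close>

definition germs_agree :: "'p topology \<Rightarrow> ('p, 'r, 'g) module_presheaf \<Rightarrow> ('p set \<Rightarrow> 's \<Rightarrow> 'g) \<Rightarrow>
    'p set \<Rightarrow> ('p \<Rightarrow> ('p set \<times> 's) set) \<Rightarrow> 'g \<Rightarrow> bool" where
  "germs_agree T G \<beta> U s t \<longleftrightarrow> t \<in> carrier (sections G U) \<and>
     (\<forall>x \<in> U. \<forall>(V, c) \<in> s x. \<exists>W. openin T W \<and> x \<in> W \<and> W \<subseteq> U \<inter> V \<and> restr G U W t = restr G V W (\<beta> V c))"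

text \<open>For sections of the sheafification, uniqueness comes from locality of the target and
  existence from gluing.\<close>

definition sheafify_lift :: "'p topology \<Rightarrow> ('p, 'r, 'g) module_presheaf \<Rightarrow> ('p set \<Rightarrow> 's \<Rightarrow> 'g) \<Rightarrow>
    'p set \<Rightarrow> ('p \<Rightarrow> ('p set \<times> 's) set) \<Rightarrow> 'g" where
  "sheafify_lift T G \<beta> U s = (THE t. germs_agree T G \<beta> U s t)"

section \<open>The universal property of sheafification\<close>

text \<open>Of \<open>P\<close> only closure under restriction and the operations is asked. Every
  comparison of sections is made in \<open>G\<close>, after applying \<open>\<beta>\<close>, where
  the sheaf and module laws are available.\<close>

locale presheaf_to_sheaf = module_sheaf T \<O> G
  for T :: "'p topology" and \<O> :: "('p, 'r) ring_presheaf" and G :: "('p, 'r, 'g) module_presheaf" +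
  fixes P :: "('p, 'r, 's) module_presheaf" and \<beta> :: "'p set \<Rightarrow> 's \<Rightarrow> 'g"
  assumes pre_restr_closed: "\<lbrakk>openin T U; openin T V; V \<subseteq> U; c \<in> carrier (sections P U)\<rbrakk>
      \<Longrightarrow> restr P U V c \<in> carrier (sections P V)"
    and pre_add_closed: "\<lbrakk>openin T U; c \<in> carrier (sections P U); d \<in> carrier (sections P U)\<rbrakk>
      \<Longrightarrow> c \<oplus>\<^bsub>sections P U\<^esub> d \<in> carrier (sections P U)"
    and pre_smult_closed: "\<lbrakk>openin T U; a \<in> carrier (sections \<O> U); c \<in> carrier (sections P U)\<rbrakk>
      \<Longrightarrow> a \<odot>\<^bsub>sections P U\<^esub> c \<in> carrier (sections P U)"
    and map_hom: "module_sheaf_hom T \<O> P G \<beta>"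
begin

lemma map_closed: "\<lbrakk>openin T U; c \<in> carrier (sections P U)\<rbrakk> \<Longrightarrow> \<beta> U c \<in> carrier (sections G U)"
  using map_hom unfolding module_sheaf_hom_def linear_maps_def by blast

lemma map_add: "\<lbrakk>openin T U; c \<in> carrier (sections P U); d \<in> carrier (sections P U)\<rbrakk>
    \<Longrightarrow> \<beta> U (c \<oplus>\<^bsub>sections P U\<^esub> d) = \<beta> U c \<oplus>\<^bsub>sections G U\<^esub> \<beta> U d"
  using map_hom unfolding module_sheaf_hom_def linear_maps_def by blast

lemma map_smult: "\<lbrakk>openin T U; a \<in> carrier (sections \<O> U); c \<in> carrier (sections P U)\<rbrakk>
    \<Longrightarrow> \<beta> U (a \<odot>\<^bsub>sections P U\<^esub> c) = a \<odot>\<^bsub>sections G U\<^esub> \<beta> U c"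
  using map_hom unfolding module_sheaf_hom_def linear_maps_def by blast

lemma map_natural: "\<lbrakk>openin T U; openin T V; V \<subseteq> U; c \<in> carrier (sections P U)\<rbrakk>
    \<Longrightarrow> \<beta> V (restr P U V c) = restr G U V (\<beta> U c)"
  using map_hom unfolding module_sheaf_hom_def natural_map_def by blast

text \<open>Naturality of \<open>\<beta>\<close> on the witnessing neighbourhood turns equality of
  germs in \<open>P\<close> into equality of restrictions in \<open>G\<close>. This replaces
  arguments with the equivalence relation on germs.\<close>

lemma germ_memD:
  assumes "(V', c') \<in> germ T P x V c" "openin T V" "c \<in> carrier (sections P V)"
  shows "openin T V'" "x \<in> V'" "c' \<in> carrier (sections P V')"
    "\<exists>W. openin T W \<and> x \<in> W \<and> W \<subseteq> V \<inter> V' \<and> restr G V W (\<beta> V c) = restr G V' W (\<beta> V' c')"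
proof -
  show V': "openin T V'" and "x \<in> V'" and c': "c' \<in> carrier (sections P V')"
    using assms(1) by (auto simp: germ_def)
  obtain W where W: "openin T W" "x \<in> W" "W \<subseteq> V \<inter> V'" "restr P V W c = restr P V' W c'"
    using assms(1) by (auto simp: germ_def)
  then have "restr G V W (\<beta> V c) = restr G V' W (\<beta> V' c')"
    using map_natural[of V W c] map_natural[of V' W c'] V' c' assms(2,3) by auto
  then show "\<exists>W. openin T W \<and> x \<in> W \<and> W \<subseteq> V \<inter> V' \<and> restr G V W (\<beta> V c) = restr G V' W (\<beta> V' c')"
    using W by blast
qed

text \<open>Weaker than being a section of the sheafification, so it can be checked for a pointwise
  sum or multiple directly. Nonemptiness matters: at a point with an empty class
  \<open>germs_agree\<close> would be vacuous and uniqueness would fail.\<close>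

definition germ_family :: "'p set \<Rightarrow> ('p \<Rightarrow> ('p set \<times> 's) set) \<Rightarrow> bool" where
  "germ_family U s \<longleftrightarrow> (\<forall>x \<in> U. s x \<noteq> {} \<and>
     (\<forall>(V, c) \<in> s x. openin T V \<and> x \<in> V \<and> c \<in> carrier (sections P V)))"

text \<open>At each point one common representative of the germ controls both candidates on a small
  neighbourhood; locality then identifies them.\<close>

lemma germs_agree_unique:
  assumes U: "openin T U" and s: "germ_family U s"
    and t: "germs_agree T G \<beta> U s t" and t': "germs_agree T G \<beta> U s t'"
  shows "t = t'"
proof (rule eq_if_locally_eq[OF U])
  show tc: "t \<in> carrier (sections G U)" and tc': "t' \<in> carrier (sections G U)"
    using t t' by (auto simp: germs_agree_def)
  fix x assume x: "x \<in> U"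
  obtain V c where Vc: "(V, c) \<in> s x" "openin T V" "c \<in> carrier (sections P V)"
    using s x unfolding germ_family_def by fast
  obtain W where W: "openin T W" "x \<in> W" "W \<subseteq> U \<inter> V" "restr G U W t = restr G V W (\<beta> V c)"
    using t x Vc(1) unfolding germs_agree_def by fast
  obtain W' where W': "openin T W'" "x \<in> W'" "W' \<subseteq> U \<inter> V" "restr G U W' t' = restr G V W' (\<beta> V c)"
    using t' x Vc(1) unfolding germs_agree_def by fast
  have o: "openin T (W \<inter> W')" using W W' by blast
  have b: "\<beta> V c \<in> carrier (sections G V)" using Vc by (simp add: map_closed)
  have "restr G U (W \<inter> W') t = restr G V (W \<inter> W') (\<beta> V c)"
    by (rule restr_eq_mono[OF W(4)]) (use U Vc W o b tc in auto)
  moreover have "restr G U (W \<inter> W') t' = restr G V (W \<inter> W') (\<beta> V c)"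
    by (rule restr_eq_mono[OF W'(4)]) (use U Vc W' o b tc' in auto)
  ultimately show "\<exists>W. openin T W \<and> x \<in> W \<and> W \<subseteq> U \<and> restr G U W t = restr G U W t'"
    using o W W' by (intro exI[of _ "W \<inter> W'"]) auto
qed

text \<open>The way in which the lift is computed throughout: exhibit a candidate section and check
  its germs.\<close>

lemma sheafify_lift_eqI:
  "\<lbrakk>openin T U; germ_family U s; germs_agree T G \<beta> U s t\<rbrakk> \<Longrightarrow> sheafify_lift T G \<beta> U s = t"
  unfolding sheafify_lift_def by (rule the_equality) (auto intro: germs_agree_unique)

lemma sheafification_local:
  assumes "s \<in> carrier (sections (sheafification T \<O> P) U)" "x \<in> U"
  obtains V c where "openin T V" "x \<in> V" "V \<subseteq> U" "c \<in> carrier (sections P V)"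
    "\<And>y. y \<in> V \<Longrightarrow> s y = germ T P y V c"
  using assms by (auto simp: sheafification_def)

lemma sheafification_germ_family:
  assumes "s \<in> carrier (sections (sheafification T \<O> P) U)"
  shows "germ_family U s"
  unfolding germ_family_def
proof (intro ballI conjI)
  fix x assume "x \<in> U"
  with assms obtain V c where V: "openin T V" "x \<in> V" "V \<subseteq> U" "c \<in> carrier (sections P V)"
    and s: "\<And>y. y \<in> V \<Longrightarrow> s y = germ T P y V c"
    using sheafification_local by blast
  show "s x \<noteq> {}"
    using germ_self[of T V x c P] V s by auto
  fix z assume "z \<in> s x"
  then show "case z of (V, c) \<Rightarrow> openin T V \<and> x \<in> V \<and> c \<in> carrier (sections P V)"
    using V s germ_memD(1-3) by auto
qed

text \<open>On small open sets the family of germs comes from a section of \<open>P\<close>. The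
  images of these sections under \<open>\<beta>\<close> are glued in \<open>G\<close>.\<close>

lemma germs_agree_exists:
  assumes U: "openin T U" and s: "s \<in> carrier (sections (sheafification T \<O> P) U)"
  shows "\<exists>t. germs_agree T G \<beta> U s t"
proof -
  define good where "good V c \<longleftrightarrow> c \<in> carrier (sections P V) \<and> (\<forall>y \<in> V. s y = germ T P y V c)" for V c
  define \<U> where "\<U> = {V. openin T V \<and> V \<subseteq> U \<and> (\<exists>c. good V c)}"
  \<comment> \<open>Gluing expects a family indexed by the open sets themselves, so one representing
    section is chosen for each member of the cover.\<close>
  define c where "c V = (SOME c. good V c)" for V
  have c: "c V \<in> carrier (sections P V)" "\<And>y. y \<in> V \<Longrightarrow> s y = germ T P y V (c V)" if "V \<in> \<U>" for V
  proof -
    have "good V (c V)"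
      using that unfolding c_def \<U>_def by (auto intro: someI_ex)
    then show "c V \<in> carrier (sections P V)" "\<And>y. y \<in> V \<Longrightarrow> s y = germ T P y V (c V)"
      by (auto simp: good_def)
  qed
  have cover: "\<Union>\<U> = U"
  proof (intro subset_antisym subsetI)
    fix x assume "x \<in> U"
    with s obtain V c where "openin T V" "x \<in> V" "V \<subseteq> U" "c \<in> carrier (sections P V)"
      "\<And>y. y \<in> V \<Longrightarrow> s y = germ T P y V c"
      using sheafification_local by blast
    then have "V \<in> \<U>" by (auto simp: \<U>_def good_def)
    then show "x \<in> \<Union>\<U>" using \<open>x \<in> V\<close> by blast
  qed (auto simp: \<U>_def)
  have open\<U>: "openin T V" if "V \<in> \<U>" for V using that by (simp add: \<U>_def)
  have compat: "restr G V (V \<inter> W) (\<beta> V (c V)) = restr G W (V \<inter> W) (\<beta> W (c W))"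
    if V: "V \<in> \<U>" and W: "W \<in> \<U>" for V W
  \<comment> \<open>Equal germs give agreement only near each point of the overlap; locality of
    \<open>G\<close> extends it to the whole overlap.\<close>
  proof (rule eq_if_locally_eq)
    show o: "openin T (V \<inter> W)" using V W open\<U> by blast
    have bV: "\<beta> V (c V) \<in> carrier (sections G V)" and bW: "\<beta> W (c W) \<in> carrier (sections G W)"
      using V W by (simp_all add: map_closed open\<U> c)
    show "restr G V (V \<inter> W) (\<beta> V (c V)) \<in> carrier (sections G (V \<inter> W))"
      "restr G W (V \<inter> W) (\<beta> W (c W)) \<in> carrier (sections G (V \<inter> W))"
      using o open\<U> V W bV bW by (auto intro!: restr_closed)
    fix x assume x: "x \<in> V \<inter> W"
    \<comment> \<open>Both chosen sections represent the same germ \<open>s x\<close>.\<close>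
    have "(W, c W) \<in> germ T P x V (c V)"
      using germ_self[of T W x "c W" P] c(1)[OF W] c(2)[OF V] c(2)[OF W] x open\<U>[OF W] by auto
    from germ_memD(4)[OF this] obtain D where D: "openin T D" "x \<in> D" "D \<subseteq> V \<inter> W"
      "restr G V D (\<beta> V (c V)) = restr G W D (\<beta> W (c W))"
      using V open\<U> c by blast
    have "restr G (V \<inter> W) D (restr G V (V \<inter> W) (\<beta> V (c V))) = restr G V D (\<beta> V (c V))"
      using D o open\<U> V bV by (intro restr_comp) auto
    moreover have "restr G (V \<inter> W) D (restr G W (V \<inter> W) (\<beta> W (c W))) = restr G W D (\<beta> W (c W))"
      using D o open\<U> W bW by (intro restr_comp) auto
    ultimately show "\<exists>D. openin T D \<and> x \<in> D \<and> D \<subseteq> V \<inter> W \<and>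
        restr G (V \<inter> W) D (restr G V (V \<inter> W) (\<beta> V (c V))) =
        restr G (V \<inter> W) D (restr G W (V \<inter> W) (\<beta> W (c W)))"
      using D by auto
  qed
  have "\<exists>t \<in> carrier (sections G (\<Union>\<U>)). \<forall>V \<in> \<U>. restr G (\<Union>\<U>) V t = \<beta> V (c V)"
    by (rule gluing) (auto simp: open\<U> c map_closed intro: compat)
  then obtain t where t: "t \<in> carrier (sections G U)" "\<And>V. V \<in> \<U> \<Longrightarrow> restr G U V t = \<beta> V (c V)"
    by (auto simp: cover)
  have "\<exists>W. openin T W \<and> x \<in> W \<and> W \<subseteq> U \<inter> V' \<and> restr G U W t = restr G V' W (\<beta> V' c')"
    if x: "x \<in> U" and V': "(V', c') \<in> s x" for x V' c'
  proof -
    \<comment> \<open>An arbitrary representative of \<open>s x\<close> is compared with the glued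
      section through a member of the cover containing \<open>x\<close>.\<close>
    obtain V where V: "V \<in> \<U>" "x \<in> V" using x cover by blast
    then have "(V', c') \<in> germ T P x V (c V)" using V' c by simp
    from germ_memD(4)[OF this] obtain D where D: "openin T D" "x \<in> D" "D \<subseteq> V \<inter> V'"
      "restr G V D (\<beta> V (c V)) = restr G V' D (\<beta> V' c')"
      using V open\<U> c by blast
    have "restr G V D (restr G U V t) = restr G U D t"
      using D(1,3) t(1) U V(1) by (intro restr_comp) (auto simp: \<U>_def)
    then have "restr G U D t = restr G V' D (\<beta> V' c')"
      using D(4) t(2)[OF V(1)] by simp
    moreover have "D \<subseteq> U \<inter> V'" using D V by (auto simp: \<U>_def)
    ultimately show ?thesis using D by blast
  qed
  then show ?thesis
    using t(1) unfolding germs_agree_def by blast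
qed

lemma sheafify_lift_agree:
  assumes "openin T U" "s \<in> carrier (sections (sheafification T \<O> P) U)"
  shows "germs_agree T G \<beta> U s (sheafify_lift T G \<beta> U s)"
  using germs_agree_exists[OF assms] sheafify_lift_eqI[OF assms(1) sheafification_germ_family[OF assms(2)]]
  by auto

lemma sheafify_lift_near:
  assumes "openin T U" "s \<in> carrier (sections (sheafification T \<O> P) U)" "x \<in> U" "(V, c) \<in> s x"
  obtains W where "openin T W" "x \<in> W" "W \<subseteq> U" "W \<subseteq> V"
    "restr G U W (sheafify_lift T G \<beta> U s) = restr G V W (\<beta> V c)"
  using sheafify_lift_agree[OF assms(1,2)] assms(3,4) unfolding germs_agree_def by fast

lemma sheafify_lift_closed:
  "\<lbrakk>openin T U; s \<in> carrier (sections (sheafification T \<O> P) U)\<rbrakk>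
   \<Longrightarrow> sheafify_lift T G \<beta> U s \<in> carrier (sections G U)"
  using sheafify_lift_agree by (auto simp: germs_agree_def)

lemma germ_section_closed:
  assumes "openin T U" "c \<in> carrier (sections P U)"
  shows "(\<lambda>x \<in> U. germ T P x U c) \<in> carrier (sections (sheafification T \<O> P) U)"
  using assms by (force simp: sheafification_def)

text \<open>The lift extends \<open>\<beta>\<close> along the canonical map from \<open>P\<close> to
  its sheafification. This later evaluates f on a tensor of two sections.\<close>

lemma sheafify_lift_germ_section:
  assumes U: "openin T U" and c: "c \<in> carrier (sections P U)"
  shows "sheafify_lift T G \<beta> U (\<lambda>x \<in> U. germ T P x U c) = \<beta> U c"
proof (rule sheafify_lift_eqI[OF U sheafification_germ_family[OF germ_section_closed[OF assms]]])
  show "germs_agree T G \<beta> U (\<lambda>x \<in> U. germ T P x U c) (\<beta> U c)"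
    using germ_memD(4)[OF _ assms] map_closed[OF assms] unfolding germs_agree_def by auto
qed

section \<open>Compatibility of the lift with restriction and the module operations\<close>

text \<open>The restricted section still agrees with the germs, on neighbourhoods cut down to
  \<open>V\<close>, and uniqueness does the rest.\<close>

lemma sheafify_lift_natural: "natural_map T (sheafification T \<O> P) G (sheafify_lift T G \<beta>)"
  unfolding natural_map_def
proof (intro allI impI)
  fix U V s
  assume U: "openin T U" and V: "openin T V" "V \<subseteq> U"
    and s: "s \<in> carrier (sections (sheafification T \<O> P) U)"
  let ?t = "sheafify_lift T G \<beta> U s"
  have tc: "?t \<in> carrier (sections G U)" using U s by (rule sheafify_lift_closed)
  have fam: "germ_family V (restrict s V)"
    using sheafification_germ_family[OF s] V by (auto simp: germ_family_def)
  have "\<exists>W. openin T W \<and> x \<in> W \<and> W \<subseteq> V \<inter> D \<and> restr G V W (restr G U V ?t) = restr G D W (\<beta> D c)"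
    if x: "x \<in> V" and Dc: "(D, c) \<in> s x" for x D c
  proof -
    obtain W where W: "openin T W" "x \<in> W" "W \<subseteq> U" "W \<subseteq> D" "restr G U W ?t = restr G D W (\<beta> D c)"
      using sheafify_lift_near[OF U s] x V Dc by blast
    have D: "openin T D" "c \<in> carrier (sections P D)"
      using sheafification_germ_family[OF s] x V Dc by (auto simp: germ_family_def)
    have o: "openin T (W \<inter> V)" using W V by blast
    have "restr G V (W \<inter> V) (restr G U V ?t) = restr G U (W \<inter> V) ?t"
      using U V o tc by (intro restr_comp) auto
    also have "\<dots> = restr G D (W \<inter> V) (\<beta> D c)"
      by (rule restr_eq_mono[OF W(5)]) (use U W D o tc map_closed in auto)
    finally show ?thesis
      using o W x by (intro exI[of _ "W \<inter> V"]) auto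
  qed
  then have "germs_agree T G \<beta> V (restrict s V) (restr G U V ?t)"
    using restr_closed[OF U V tc] by (auto simp: germs_agree_def)
  from sheafify_lift_eqI[OF V(1) fam this]
  show "sheafify_lift T G \<beta> V (restr (sheafification T \<O> P) U V s) = restr G U V ?t"
    by (simp add: sheafification_def)
qed

text \<open>The sum of the two lifts is the candidate. Near a point it is compared with any
  representative of the sum germ by passing to a neighbourhood on which everything is expressed
  through one pair of representatives of the summands.\<close>

lemma sheafify_lift_add:
  assumes U: "openin T U" and s: "s \<in> carrier (sections (sheafification T \<O> P) U)"
    and t: "t \<in> carrier (sections (sheafification T \<O> P) U)"
  shows "sheafify_lift T G \<beta> U (s \<oplus>\<^bsub>sections (sheafification T \<O> P) U\<^esub> t)
    = sheafify_lift T G \<beta> U s \<oplus>\<^bsub>sections G U\<^esub> sheafify_lift T G \<beta> U t"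
proof -
  let ?S = "sheafify_lift T G \<beta> U s" and ?T = "sheafify_lift T G \<beta> U t"
  let ?sum = "\<lambda>A a B b. restr P A (A \<inter> B) a \<oplus>\<^bsub>sections P (A \<inter> B)\<^esub> restr P B (A \<inter> B) b"
  define st where "st = (\<lambda>x \<in> U. stalk_add T P x (s x) (t x))"
  have st_eq: "s \<oplus>\<^bsub>sections (sheafification T \<O> P) U\<^esub> t = st"
    by (simp add: sheafification_def st_def)
  note sf = sheafification_germ_family[OF s] and tf = sheafification_germ_family[OF t]
  have Sc: "?S \<in> carrier (sections G U)" and Tc: "?T \<in> carrier (sections G U)"
    using U s t by (simp_all add: sheafify_lift_closed)
  interpret MU: Module.module "sections \<O> U" "sections G U" by (rule sections_module[OF U])
  \<comment> \<open>\<open>stalk_add\<close> is a union over all pairs of representatives, so a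
    member of it belongs to the germ of one particular sum.\<close>
  have mem: "\<exists>A a B b. (A, a) \<in> s x \<and> (B, b) \<in> t x \<and> z \<in> germ T P x (A \<inter> B) (?sum A a B b)"
    if "x \<in> U" "z \<in> st x" for x z
    using that by (fastforce simp: st_def stalk_add_def)
  have rep: "openin T A \<and> openin T B \<and> openin T (A \<inter> B) \<and> x \<in> A \<inter> B \<and> a \<in> carrier (sections P A) \<and>
      b \<in> carrier (sections P B) \<and> ?sum A a B b \<in> carrier (sections P (A \<inter> B))"
    if "x \<in> U" "(A, a) \<in> s x" "(B, b) \<in> t x" for x A a B b
  proof -
    have "openin T A" "openin T B" "x \<in> A \<inter> B" "a \<in> carrier (sections P A)" "b \<in> carrier (sections P B)"
      using sf tf that by (auto simp: germ_family_def)
    moreover then have "openin T (A \<inter> B)" by blast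
    ultimately show ?thesis
      by (auto intro!: pre_add_closed pre_restr_closed)
  qed
  have fam: "germ_family U st"
    unfolding germ_family_def
  proof (intro ballI conjI)
    fix x assume x: "x \<in> U"
    obtain A a B b where ab: "(A, a) \<in> s x" "(B, b) \<in> t x"
      using sf tf x unfolding germ_family_def by fast
    then have "(A \<inter> B, ?sum A a B b) \<in> germ T P x (A \<inter> B) (?sum A a B b)"
      using rep[OF x ab] by (intro germ_self) auto
    then show "st x \<noteq> {}"
      using x ab by (force simp: st_def stalk_add_def)
    fix z assume "z \<in> st x"
    with mem[OF x] obtain A a B b where "(A, a) \<in> s x" "(B, b) \<in> t x"
      "z \<in> germ T P x (A \<inter> B) (?sum A a B b)" by blast
    then show "case z of (V, c) \<Rightarrow> openin T V \<and> x \<in> V \<and> c \<in> carrier (sections P V)"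
      using rep[OF x] germ_memD(1-3) by blast
  qed
  have "\<exists>W. openin T W \<and> x \<in> W \<and> W \<subseteq> U \<inter> V \<and>
      restr G U W (?S \<oplus>\<^bsub>sections G U\<^esub> ?T) = restr G V W (\<beta> V c)"
    if x: "x \<in> U" and Vc: "(V, c) \<in> st x" for x V c
  proof -
    obtain A a B b where ab: "(A, a) \<in> s x" "(B, b) \<in> t x"
      and g: "(V, c) \<in> germ T P x (A \<inter> B) (?sum A a B b)"
      using mem[OF x Vc] by blast
    note r = rep[OF x ab]
    obtain D where D: "openin T D" "x \<in> D" "D \<subseteq> (A \<inter> B) \<inter> V"
      "restr G (A \<inter> B) D (\<beta> (A \<inter> B) (?sum A a B b)) = restr G V D (\<beta> V c)"
      using germ_memD(4)[OF g] r by blast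
    have V: "openin T V" "c \<in> carrier (sections P V)" using germ_memD[OF g] r by blast+
    obtain W1 where W1: "openin T W1" "x \<in> W1" "W1 \<subseteq> U" "W1 \<subseteq> A" "restr G U W1 ?S = restr G A W1 (\<beta> A a)"
      using sheafify_lift_near[OF U s x ab(1)] by blast
    obtain W2 where W2: "openin T W2" "x \<in> W2" "W2 \<subseteq> U" "W2 \<subseteq> B" "restr G U W2 ?T = restr G B W2 (\<beta> B b)"
      using sheafify_lift_near[OF U t x ab(2)] by blast
    \<comment> \<open>\<open>D\<close> witnesses that \<open>c\<close> has the germ of the sum of
      representatives; \<open>W1\<close> and \<open>W2\<close> witness the values of the lifts of
      \<open>s\<close> and \<open>t\<close>.\<close>
    define W where "W = D \<inter> (W1 \<inter> W2)"
    have W: "openin T W" "x \<in> W" "W \<subseteq> D" "W \<subseteq> W1" "W \<subseteq> W2" "W \<subseteq> U" "W \<subseteq> V" "W \<subseteq> A" "W \<subseteq> B"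
      using D W1 W2 by (auto simp: W_def)
    have \<beta>a: "\<beta> A a \<in> carrier (sections G A)" and \<beta>b: "\<beta> B b \<in> carrier (sections G B)"
      and \<beta>c: "\<beta> V c \<in> carrier (sections G V)"
      and \<beta>s: "\<beta> (A \<inter> B) (?sum A a B b) \<in> carrier (sections G (A \<inter> B))"
      using r V by (auto intro!: map_closed)
    have "restr G U W (?S \<oplus>\<^bsub>sections G U\<^esub> ?T) = restr G U W ?S \<oplus>\<^bsub>sections G W\<^esub> restr G U W ?T"
      using U W Sc Tc by (intro restr_add) auto
    also have "restr G U W ?S = restr G A W (\<beta> A a)"
      by (rule restr_eq_mono[OF W1(5)]) (use U W W1 r Sc \<beta>a in auto)
    also have "restr G U W ?T = restr G B W (\<beta> B b)"
      by (rule restr_eq_mono[OF W2(5)]) (use U W W2 r Tc \<beta>b in auto)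
    also have "restr G A W (\<beta> A a) = restr G (A \<inter> B) W (restr G A (A \<inter> B) (\<beta> A a))"
      using r W \<beta>a by (intro restr_comp[symmetric]) auto
    also have "restr G B W (\<beta> B b) = restr G (A \<inter> B) W (restr G B (A \<inter> B) (\<beta> B b))"
      using r W \<beta>b by (intro restr_comp[symmetric]) auto
    also have "restr G (A \<inter> B) W (restr G A (A \<inter> B) (\<beta> A a)) \<oplus>\<^bsub>sections G W\<^esub>
        restr G (A \<inter> B) W (restr G B (A \<inter> B) (\<beta> B b)) =
        restr G (A \<inter> B) W (restr G A (A \<inter> B) (\<beta> A a) \<oplus>\<^bsub>sections G (A \<inter> B)\<^esub> restr G B (A \<inter> B) (\<beta> B b))"
      using r W \<beta>a \<beta>b by (intro restr_add[symmetric]) (auto intro!: restr_closed)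
    also have "restr G A (A \<inter> B) (\<beta> A a) \<oplus>\<^bsub>sections G (A \<inter> B)\<^esub> restr G B (A \<inter> B) (\<beta> B b)
        = \<beta> (A \<inter> B) (?sum A a B b)"
      using r by (simp add: map_add map_natural pre_restr_closed)
    also have "restr G (A \<inter> B) W (\<beta> (A \<inter> B) (?sum A a B b)) = restr G V W (\<beta> V c)"
      by (rule restr_eq_mono[OF D(4)]) (use r V W D \<beta>s \<beta>c in auto)
    finally show ?thesis
      using W by (intro exI[of _ W]) auto
  qed
  then have "germs_agree T G \<beta> U st (?S \<oplus>\<^bsub>sections G U\<^esub> ?T)"
    using Sc Tc unfolding germs_agree_def by auto
  then show ?thesis
    using sheafify_lift_eqI[OF U fam] by (simp add: st_eq)
qed

text \<open>The argument for sums with a single representative at a time. The scalar lives on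
  \<open>U\<close>, so a representative over \<open>A\<close> is first restricted to the
  intersection of \<open>U\<close> and \<open>A\<close>.\<close>

lemma sheafify_lift_smult:
  assumes U: "openin T U" and a: "a \<in> carrier (sections \<O> U)"
    and s: "s \<in> carrier (sections (sheafification T \<O> P) U)"
  shows "sheafify_lift T G \<beta> U (a \<odot>\<^bsub>sections (sheafification T \<O> P) U\<^esub> s)
    = a \<odot>\<^bsub>sections G U\<^esub> sheafify_lift T G \<beta> U s"
proof -
  let ?S = "sheafify_lift T G \<beta> U s"
  let ?prod = "\<lambda>A b. restr \<O> U (U \<inter> A) a \<odot>\<^bsub>sections P (U \<inter> A)\<^esub> restr P A (U \<inter> A) b"
  define as where "as = (\<lambda>x \<in> U. \<Union>(A, b) \<in> s x. germ T P x (U \<inter> A) (?prod A b))"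
  have as_eq: "a \<odot>\<^bsub>sections (sheafification T \<O> P) U\<^esub> s = as"
    by (simp add: sheafification_def as_def)
  note sf = sheafification_germ_family[OF s]
  have Sc: "?S \<in> carrier (sections G U)"
    using U s by (simp add: sheafify_lift_closed)
  interpret MU: Module.module "sections \<O> U" "sections G U" by (rule sections_module[OF U])
  have mem: "\<exists>A b. (A, b) \<in> s x \<and> z \<in> germ T P x (U \<inter> A) (?prod A b)"
    if "x \<in> U" "z \<in> as x" for x z
    using that by (fastforce simp: as_def)
  have rep: "openin T A \<and> openin T (U \<inter> A) \<and> x \<in> U \<inter> A \<and> b \<in> carrier (sections P A) \<and>
      restr \<O> U (U \<inter> A) a \<in> carrier (sections \<O> (U \<inter> A)) \<and> ?prod A b \<in> carrier (sections P (U \<inter> A))"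
    if "x \<in> U" "(A, b) \<in> s x" for x A b
  proof -
    have "openin T A" "x \<in> U \<inter> A" "b \<in> carrier (sections P A)"
      using sf that by (auto simp: germ_family_def)
    moreover then have "openin T (U \<inter> A)" using U by blast
    ultimately show ?thesis
      using a U by (auto intro!: pre_smult_closed pre_restr_closed base.restr_closed)
  qed
  have fam: "germ_family U as"
    unfolding germ_family_def
  proof (intro ballI conjI)
    fix x assume x: "x \<in> U"
    obtain A b where ab: "(A, b) \<in> s x"
      using sf x unfolding germ_family_def by fast
    then have "(U \<inter> A, ?prod A b) \<in> germ T P x (U \<inter> A) (?prod A b)"
      using rep[OF x ab] by (intro germ_self) auto
    then show "as x \<noteq> {}"
      using x ab by (force simp: as_def)
    fix z assume "z \<in> as x"
    with mem[OF x] obtain A b where "(A, b) \<in> s x"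
      "z \<in> germ T P x (U \<inter> A) (?prod A b)" by blast
    then show "case z of (V, c) \<Rightarrow> openin T V \<and> x \<in> V \<and> c \<in> carrier (sections P V)"
      using rep[OF x] germ_memD(1-3) by blast
  qed
  have "\<exists>W. openin T W \<and> x \<in> W \<and> W \<subseteq> U \<inter> V \<and>
      restr G U W (a \<odot>\<^bsub>sections G U\<^esub> ?S) = restr G V W (\<beta> V c)"
    if x: "x \<in> U" and Vc: "(V, c) \<in> as x" for x V c
  proof -
    obtain A b where ab: "(A, b) \<in> s x"
      and g: "(V, c) \<in> germ T P x (U \<inter> A) (?prod A b)"
      using mem[OF x Vc] by blast
    note r = rep[OF x ab]
    obtain D where D: "openin T D" "x \<in> D" "D \<subseteq> (U \<inter> A) \<inter> V"
      "restr G (U \<inter> A) D (\<beta> (U \<inter> A) (?prod A b)) = restr G V D (\<beta> V c)"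
      using germ_memD(4)[OF g] r by blast
    have V: "openin T V" "c \<in> carrier (sections P V)" using germ_memD[OF g] r by blast+
    obtain W1 where W1: "openin T W1" "x \<in> W1" "W1 \<subseteq> U" "W1 \<subseteq> A" "restr G U W1 ?S = restr G A W1 (\<beta> A b)"
      using sheafify_lift_near[OF U s x ab] by blast
    define W where "W = D \<inter> W1"
    have W: "openin T W" "x \<in> W" "W \<subseteq> D" "W \<subseteq> W1" "W \<subseteq> U" "W \<subseteq> V" "W \<subseteq> A"
      using D W1 by (auto simp: W_def)
    have \<beta>b: "\<beta> A b \<in> carrier (sections G A)" and \<beta>c: "\<beta> V c \<in> carrier (sections G V)"
      and \<beta>s: "\<beta> (U \<inter> A) (?prod A b) \<in> carrier (sections G (U \<inter> A))"
      using r V by (auto intro!: map_closed)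
    have "restr G U W (a \<odot>\<^bsub>sections G U\<^esub> ?S) = restr \<O> U W a \<odot>\<^bsub>sections G W\<^esub> restr G U W ?S"
      using U W Sc a by (intro restr_smult) auto
    also have "restr G U W ?S = restr G A W (\<beta> A b)"
      by (rule restr_eq_mono[OF W1(5)]) (use U W W1 r Sc \<beta>b in auto)
    also have "restr G A W (\<beta> A b) = restr G (U \<inter> A) W (restr G A (U \<inter> A) (\<beta> A b))"
      using r W \<beta>b by (intro restr_comp[symmetric]) auto
    also have "restr \<O> U W a = restr \<O> (U \<inter> A) W (restr \<O> U (U \<inter> A) a)"
      using r W U a by (intro base.restr_comp[symmetric]) auto
    also have "restr \<O> (U \<inter> A) W (restr \<O> U (U \<inter> A) a) \<odot>\<^bsub>sections G W\<^esub>
        restr G (U \<inter> A) W (restr G A (U \<inter> A) (\<beta> A b)) =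
        restr G (U \<inter> A) W (restr \<O> U (U \<inter> A) a \<odot>\<^bsub>sections G (U \<inter> A)\<^esub> restr G A (U \<inter> A) (\<beta> A b))"
      using r W \<beta>b by (intro restr_smult[symmetric]) (auto intro!: restr_closed)
    also have "restr \<O> U (U \<inter> A) a \<odot>\<^bsub>sections G (U \<inter> A)\<^esub> restr G A (U \<inter> A) (\<beta> A b)
        = \<beta> (U \<inter> A) (?prod A b)"
      using r by (simp add: map_smult map_natural pre_restr_closed)
    also have "restr G (U \<inter> A) W (\<beta> (U \<inter> A) (?prod A b)) = restr G V W (\<beta> V c)"
      by (rule restr_eq_mono[OF D(4)]) (use r V W D \<beta>s \<beta>c in auto)
    finally show ?thesis
      using W by (intro exI[of _ W]) auto
  qed
  then have "germs_agree T G \<beta> U as (a \<odot>\<^bsub>sections G U\<^esub> ?S)"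
    using Sc a unfolding germs_agree_def by auto
  then show ?thesis
    using sheafify_lift_eqI[OF U fam] by (simp add: as_eq)
qed

lemma sheafify_lift_hom: "module_sheaf_hom T \<O> (sheafification T \<O> P) G (sheafify_lift T G \<beta>)"
  unfolding module_sheaf_hom_def linear_maps_def
  by (auto simp: sheafify_lift_natural sheafify_lift_closed sheafify_lift_add sheafify_lift_smult)

end


section \<open>Split square-zero extensions of rings\<close>

lemma twisted_ring_simps [simp]:
  "carrier (twisted_ring A M b) = carrier A \<times> carrier M"
  "(x, m) \<otimes>\<^bsub>twisted_ring A M b\<^esub> (x', m') =
     (x \<otimes>\<^bsub>A\<^esub> x', ((x \<odot>\<^bsub>M\<^esub> m') \<oplus>\<^bsub>M\<^esub> (x' \<odot>\<^bsub>M\<^esub> m)) \<oplus>\<^bsub>M\<^esub> b x x')"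
  "\<one>\<^bsub>twisted_ring A M b\<^esub> = (\<one>\<^bsub>A\<^esub>, \<ominus>\<^bsub>M\<^esub> b \<one>\<^bsub>A\<^esub> \<one>\<^bsub>A\<^esub>)"
  "\<zero>\<^bsub>twisted_ring A M b\<^esub> = (\<zero>\<^bsub>A\<^esub>, \<zero>\<^bsub>M\<^esub>)"
  "(x, m) \<oplus>\<^bsub>twisted_ring A M b\<^esub> (x', m') = (x \<oplus>\<^bsub>A\<^esub> x', m \<oplus>\<^bsub>M\<^esub> m')"
  by (simp_all add: twisted_ring_def)

text \<open>Moves the negative terms of the cocycle identity to the other side, which suits
  rewriting modulo associativity and commutativity.\<close>

lemma (in abelian_group) alternating_sum_zeroD:
  assumes "p \<ominus> q \<oplus> r \<ominus> s = \<zero>"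
    and "p \<in> carrier G" "q \<in> carrier G" "r \<in> carrier G" "s \<in> carrier G"
  shows "p \<oplus> r = q \<oplus> s"
  using assms by (metis (lifting) a_assoc a_closed a_comm add.inv_solve_right' l_zero minus_closed minus_eq)

text \<open>The cocycle identity gives the unit laws as well as associativity: evaluated with two
  arguments equal to 1, it expresses \<open>b \<one> x\<close> and \<open>b x \<one>\<close> as x
  times \<open>b \<one> \<one>\<close>, exactly what the second component of the unit
  cancels.\<close>

lemma twisted_ring_monoid:
  fixes A (structure)
  assumes "Module.module A M"
    and b: "\<And>x y. \<lbrakk>x \<in> carrier A; y \<in> carrier A\<rbrakk> \<Longrightarrow> b x y \<in> carrier M"
    and coc: "cocycle A M b"
  shows "Group.monoid (twisted_ring A M b)"
proof -
  interpret Module.module A M by fact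
  have coc': "x \<odot>\<^bsub>M\<^esub> b y z \<oplus>\<^bsub>M\<^esub> b x (y \<otimes> z) = b (x \<otimes> y) z \<oplus>\<^bsub>M\<^esub> z \<odot>\<^bsub>M\<^esub> b x y"
    if "x \<in> carrier A" "y \<in> carrier A" "z \<in> carrier A" for x y z
    using that coc unfolding cocycle_def by (intro M.alternating_sum_zeroD) (auto simp: b)
  \<comment> \<open>In the identity for (1, 1, x) the term \<open>b \<one> x\<close> occurs twice on
    the left and once on the right; cancelling one copy leaves the claim.\<close>
  have left: "b \<one> x = x \<odot>\<^bsub>M\<^esub> b \<one> \<one>" if "x \<in> carrier A" for x
    using coc'[of \<one> \<one> x] that by (simp add: b)
  have right: "b x \<one> = x \<odot>\<^bsub>M\<^esub> b \<one> \<one>" if "x \<in> carrier A" for x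
    using coc'[of x \<one> \<one>] that by (simp add: b)
  have assoc: "((x \<otimes> y) \<odot>\<^bsub>M\<^esub> n \<oplus>\<^bsub>M\<^esub> z \<odot>\<^bsub>M\<^esub> (x \<odot>\<^bsub>M\<^esub> m \<oplus>\<^bsub>M\<^esub> y \<odot>\<^bsub>M\<^esub> l \<oplus>\<^bsub>M\<^esub> b x y)) \<oplus>\<^bsub>M\<^esub> b (x \<otimes> y) z
      = (x \<odot>\<^bsub>M\<^esub> (y \<odot>\<^bsub>M\<^esub> n \<oplus>\<^bsub>M\<^esub> z \<odot>\<^bsub>M\<^esub> m \<oplus>\<^bsub>M\<^esub> b y z) \<oplus>\<^bsub>M\<^esub> (y \<otimes> z) \<odot>\<^bsub>M\<^esub> l) \<oplus>\<^bsub>M\<^esub> b x (y \<otimes> z)"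
    if c: "x \<in> carrier A" "y \<in> carrier A" "z \<in> carrier A" "l \<in> carrier M" "m \<in> carrier M" "n \<in> carrier M"
    for x y z l m n
  proof -
    \<comment> \<open>The part common to both bracketings. What remains on each side is one side of
      the cocycle identity.\<close>
    let ?u = "(x \<otimes> y) \<odot>\<^bsub>M\<^esub> n \<oplus>\<^bsub>M\<^esub> ((x \<otimes> z) \<odot>\<^bsub>M\<^esub> m \<oplus>\<^bsub>M\<^esub> (y \<otimes> z) \<odot>\<^bsub>M\<^esub> l)"
    have zx: "z \<odot>\<^bsub>M\<^esub> (x \<odot>\<^bsub>M\<^esub> m) = (x \<otimes> z) \<odot>\<^bsub>M\<^esub> m" "z \<odot>\<^bsub>M\<^esub> (y \<odot>\<^bsub>M\<^esub> l) = (y \<otimes> z) \<odot>\<^bsub>M\<^esub> l"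
      "x \<odot>\<^bsub>M\<^esub> (y \<odot>\<^bsub>M\<^esub> n) = (x \<otimes> y) \<odot>\<^bsub>M\<^esub> n" "x \<odot>\<^bsub>M\<^esub> (z \<odot>\<^bsub>M\<^esub> m) = (x \<otimes> z) \<odot>\<^bsub>M\<^esub> m"
      using c by (simp_all add: smult_assoc1[symmetric] R.m_comm)
    have "((x \<otimes> y) \<odot>\<^bsub>M\<^esub> n \<oplus>\<^bsub>M\<^esub> z \<odot>\<^bsub>M\<^esub> (x \<odot>\<^bsub>M\<^esub> m \<oplus>\<^bsub>M\<^esub> y \<odot>\<^bsub>M\<^esub> l \<oplus>\<^bsub>M\<^esub> b x y)) \<oplus>\<^bsub>M\<^esub> b (x \<otimes> y) z
        = ?u \<oplus>\<^bsub>M\<^esub> (b (x \<otimes> y) z \<oplus>\<^bsub>M\<^esub> z \<odot>\<^bsub>M\<^esub> b x y)"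
      using c b by (simp add: smult_r_distr zx M.a_ac)
    also have "b (x \<otimes> y) z \<oplus>\<^bsub>M\<^esub> z \<odot>\<^bsub>M\<^esub> b x y = x \<odot>\<^bsub>M\<^esub> b y z \<oplus>\<^bsub>M\<^esub> b x (y \<otimes> z)"
      using coc' c by simp
    also have "?u \<oplus>\<^bsub>M\<^esub> (x \<odot>\<^bsub>M\<^esub> b y z \<oplus>\<^bsub>M\<^esub> b x (y \<otimes> z)) =
      (x \<odot>\<^bsub>M\<^esub> (y \<odot>\<^bsub>M\<^esub> n \<oplus>\<^bsub>M\<^esub> z \<odot>\<^bsub>M\<^esub> m \<oplus>\<^bsub>M\<^esub> b y z) \<oplus>\<^bsub>M\<^esub> (y \<otimes> z) \<odot>\<^bsub>M\<^esub> l) \<oplus>\<^bsub>M\<^esub> b x (y \<otimes> z)"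
      using c b by (simp add: smult_r_distr zx M.a_ac)
    finally show ?thesis .
  qed
  have unit: "(m \<oplus>\<^bsub>M\<^esub> \<ominus>\<^bsub>M\<^esub> w) \<oplus>\<^bsub>M\<^esub> w = m" "(\<ominus>\<^bsub>M\<^esub> w \<oplus>\<^bsub>M\<^esub> m) \<oplus>\<^bsub>M\<^esub> w = m"
    if "m \<in> carrier M" "w \<in> carrier M" for m w
  proof -
    show "(m \<oplus>\<^bsub>M\<^esub> \<ominus>\<^bsub>M\<^esub> w) \<oplus>\<^bsub>M\<^esub> w = m"
      using that by (simp add: M.a_assoc M.l_neg)
    then show "(\<ominus>\<^bsub>M\<^esub> w \<oplus>\<^bsub>M\<^esub> m) \<oplus>\<^bsub>M\<^esub> w = m"
      using that by (simp add: M.a_comm)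
  qed
  show ?thesis
  proof (rule monoidI)
    fix p q r
    assume "p \<in> carrier (twisted_ring A M b)" "q \<in> carrier (twisted_ring A M b)"
      "r \<in> carrier (twisted_ring A M b)"
    then show "(p \<otimes>\<^bsub>twisted_ring A M b\<^esub> q) \<otimes>\<^bsub>twisted_ring A M b\<^esub> r
        = p \<otimes>\<^bsub>twisted_ring A M b\<^esub> (q \<otimes>\<^bsub>twisted_ring A M b\<^esub> r)"
      by (cases p; cases q; cases r) (simp add: assoc R.m_assoc)
  next
    fix p assume "p \<in> carrier (twisted_ring A M b)"
    then obtain x m where p: "p = (x, m)" "x \<in> carrier A" "m \<in> carrier M" by auto
    show "\<one>\<^bsub>twisted_ring A M b\<^esub> \<otimes>\<^bsub>twisted_ring A M b\<^esub> p = p"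
      using p left[of x] by (simp add: b smult_r_minus unit)
    show "p \<otimes>\<^bsub>twisted_ring A M b\<^esub> \<one>\<^bsub>twisted_ring A M b\<^esub> = p"
      using p right[of x] by (simp add: b smult_r_minus unit)
  qed (auto simp: b)
qed

lemma twisted_ring_mult_comm:
  fixes A (structure)
  assumes "Module.module A M" and "symmetric_on (carrier A) b"
    and "p \<in> carrier (twisted_ring A M b)" "q \<in> carrier (twisted_ring A M b)"
  shows "p \<otimes>\<^bsub>twisted_ring A M b\<^esub> q = q \<otimes>\<^bsub>twisted_ring A M b\<^esub> p"
proof -
  interpret Module.module A M by fact
  show ?thesis
    using assms(2-4) by (cases p; cases q) (auto simp: symmetric_on_def R.m_comm M.a_comm)
qed

text \<open>Injectivity of \<open>\<phi>\<close> pulls the equational axioms back from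
  \<open>E\<close>; surjectivity supplies the negatives. In this way distributivity of the twisted
  product is inherited from the extension ring.\<close>

lemma cring_pullback:
  fixes S (structure)
  assumes "cring E" and bij: "bij_betw \<phi> (carrier S) (carrier E)"
    and closed: "\<And>x y. \<lbrakk>x \<in> carrier S; y \<in> carrier S\<rbrakk> \<Longrightarrow> x \<oplus> y \<in> carrier S"
      "\<And>x y. \<lbrakk>x \<in> carrier S; y \<in> carrier S\<rbrakk> \<Longrightarrow> x \<otimes> y \<in> carrier S"
      "\<zero> \<in> carrier S" "\<one> \<in> carrier S"
    and hom: "\<And>x y. \<lbrakk>x \<in> carrier S; y \<in> carrier S\<rbrakk> \<Longrightarrow> \<phi> (x \<oplus> y) = \<phi> x \<oplus>\<^bsub>E\<^esub> \<phi> y"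
      "\<And>x y. \<lbrakk>x \<in> carrier S; y \<in> carrier S\<rbrakk> \<Longrightarrow> \<phi> (x \<otimes> y) = \<phi> x \<otimes>\<^bsub>E\<^esub> \<phi> y"
      "\<phi> \<zero> = \<zero>\<^bsub>E\<^esub>" "\<phi> \<one> = \<one>\<^bsub>E\<^esub>"
  shows "cring S" "\<phi> \<in> ring_iso S E"
proof -
  interpret E: cring E by fact
  have \<phi>: "\<phi> x \<in> carrier E" if "x \<in> carrier S" for x
    using bij_betwE[OF bij] that by blast
  have inj: "x = y" if "\<phi> x = \<phi> y" "x \<in> carrier S" "y \<in> carrier S" for x y
    using bij_betw_imp_inj_on[OF bij] that by (simp add: inj_onD)
  have neg: "\<exists>y \<in> carrier S. y \<oplus> x = \<zero>" if "x \<in> carrier S" for x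
  proof -
    have "\<ominus>\<^bsub>E\<^esub> \<phi> x \<in> \<phi> ` carrier S"
      using bij_betw_imp_surj_on[OF bij] \<phi>[OF that] by simp
    then obtain y where "y \<in> carrier S" "\<phi> y = \<ominus>\<^bsub>E\<^esub> \<phi> x"
      by auto
    then show ?thesis
      using that by (intro bexI[of _ y] inj) (auto simp: closed hom \<phi> E.l_neg)
  qed
  show "cring S"
  proof (rule cringI)
    show "abelian_group S"
      by (rule abelian_groupI) (auto simp: closed hom \<phi> neg E.a_ac intro!: inj)
    show "comm_monoid S"
      by (rule comm_monoidI) (auto simp: closed hom \<phi> E.m_ac intro!: inj)
    show "(x \<oplus> y) \<otimes> z = x \<otimes> z \<oplus> y \<otimes> z"
      if "x \<in> carrier S" "y \<in> carrier S" "z \<in> carrier S" for x y z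
      using that by (intro inj) (auto simp: closed hom \<phi> E.l_distr)
  qed
  show "\<phi> \<in> ring_iso S E"
    using bij \<phi> hom by (auto simp: ring_iso_def ring_hom_def)
qed

text \<open>Polynomial identities in which values of \<open>\<sigma>\<close> and
  \<open>\<iota>\<close> are treated as independent variables, so that \<open>algebra\<close>
  decides them. In order they serve additivity, linearity, the cocycle identity, multiplicativity of
  the splitting, its surjectivity, and the unit.\<close>

lemma (in cring) defect_identities:
  assumes "s \<in> carrier R" "t \<in> carrier R" "u \<in> carrier R" "v \<in> carrier R" "w \<in> carrier R"
    "z \<in> carrier R"
  shows "(s \<oplus> t) \<otimes> u \<ominus> (v \<oplus> w) = (s \<otimes> u \<ominus> v) \<oplus> (t \<otimes> u \<ominus> w)"
    and "(u \<otimes> s) \<otimes> t \<ominus> u \<otimes> v = u \<otimes> (s \<otimes> t \<ominus> v)"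
    and "s \<otimes> (t \<otimes> u \<ominus> w) \<ominus> (v \<otimes> u \<ominus> z) \<oplus> (s \<otimes> w \<ominus> z) \<ominus> u \<otimes> (s \<otimes> t \<ominus> v) = \<zero>"
    and "(s \<oplus> v) \<otimes> (t \<oplus> w) = u \<oplus> ((s \<otimes> w) \<oplus> (t \<otimes> v) \<oplus> (s \<otimes> t \<ominus> u)) \<oplus> v \<otimes> w"
    and "s \<oplus> (u \<ominus> s) = u"
    and "s \<oplus> \<ominus> (s \<otimes> s \<ominus> s) = \<one> \<ominus> (s \<ominus> \<one>) \<otimes> (s \<ominus> \<one>)"
  using assms by algebra+

section \<open>The defect of an additive section\<close>

text \<open>The situation over one open set, with the base ring left out: \<open>\<sigma>\<close> is
  additive here, and linearity is supplied per scalar where it is used.\<close>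

locale split_square_zero_extension = A: cring A + E: cring E + M: Module.module A M
  for A :: "('a, 'k) ring_scheme" and E :: "('e, 'l) ring_scheme" and M :: "('a, 'm, 'n) module_scheme" +
  fixes \<pi> :: "'e \<Rightarrow> 'a" and \<iota> :: "'m \<Rightarrow> 'e" and \<sigma> :: "'a \<Rightarrow> 'e"
  assumes proj_ring_hom: "\<pi> \<in> ring_hom E A"
    and kernel_square_zero: "\<lbrakk>e \<in> a_kernel E A \<pi>; e' \<in> a_kernel E A \<pi>\<rbrakk> \<Longrightarrow> e \<otimes>\<^bsub>E\<^esub> e' = \<zero>\<^bsub>E\<^esub>"
    and incl_bij: "bij_betw \<iota> (carrier M) (a_kernel E A \<pi>)"
    and incl_add: "\<lbrakk>m \<in> carrier M; m' \<in> carrier M\<rbrakk> \<Longrightarrow> \<iota> (m \<oplus>\<^bsub>M\<^esub> m') = \<iota> m \<oplus>\<^bsub>E\<^esub> \<iota> m'"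
    and incl_linear: "\<lbrakk>e \<in> carrier E; m \<in> carrier M\<rbrakk> \<Longrightarrow> \<iota> (\<pi> e \<odot>\<^bsub>M\<^esub> m) = e \<otimes>\<^bsub>E\<^esub> \<iota> m"
    and sect_closed: "x \<in> carrier A \<Longrightarrow> \<sigma> x \<in> carrier E"
    and sect_add: "\<lbrakk>x \<in> carrier A; y \<in> carrier A\<rbrakk> \<Longrightarrow> \<sigma> (x \<oplus>\<^bsub>A\<^esub> y) = \<sigma> x \<oplus>\<^bsub>E\<^esub> \<sigma> y"
    and proj_sect: "x \<in> carrier A \<Longrightarrow> \<pi> (\<sigma> x) = x"
begin

lemma proj_ring_hom_cring: "ring_hom_cring E A \<pi>"
  by (intro ring_hom_cring.intro ring_hom_cring_axioms.intro E.cring_axioms A.cring_axioms proj_ring_hom)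

lemmas proj_simps [simp] =
  ring_hom_closed[OF proj_ring_hom] ring_hom_mult[OF proj_ring_hom] ring_hom_add[OF proj_ring_hom]
  ring_hom_one[OF proj_ring_hom] ring_hom_cring.hom_zero[OF proj_ring_hom_cring]
  ring_hom_cring.hom_a_inv[OF proj_ring_hom_cring]

lemma in_kernel: "e \<in> a_kernel E A \<pi> \<longleftrightarrow> e \<in> carrier E \<and> \<pi> e = \<zero>\<^bsub>A\<^esub>"
  by (simp add: a_kernel_def')

lemma incl_kernel: "m \<in> carrier M \<Longrightarrow> \<iota> m \<in> a_kernel E A \<pi>"
  using bij_betwE[OF incl_bij] by blast

lemma incl_closed: "m \<in> carrier M \<Longrightarrow> \<iota> m \<in> carrier E"
  using incl_kernel in_kernel by blast

lemma proj_incl: "m \<in> carrier M \<Longrightarrow> \<pi> (\<iota> m) = \<zero>\<^bsub>A\<^esub>"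
  using incl_kernel in_kernel by blast

lemma incl_inj: "\<lbrakk>\<iota> m = \<iota> m'; m \<in> carrier M; m' \<in> carrier M\<rbrakk> \<Longrightarrow> m = m'"
  using bij_betw_imp_inj_on[OF incl_bij] by (simp add: inj_onD)

lemma incl_group_hom: "abelian_group_hom M E \<iota>"
  by (intro abelian_group_homI M.abelian_group_axioms E.abelian_group_axioms)
    (auto simp: group_hom_def group_hom_axioms_def hom_def M.M.a_group E.a_group incl_closed incl_add)

lemmas incl_simps [simp] =
  abelian_group_hom.hom_zero[OF incl_group_hom] abelian_group_hom.hom_a_inv[OF incl_group_hom]

lemma incl_minus:
  "\<lbrakk>m \<in> carrier M; m' \<in> carrier M\<rbrakk> \<Longrightarrow> \<iota> (m \<ominus>\<^bsub>M\<^esub> m') = \<iota> m \<ominus>\<^bsub>E\<^esub> \<iota> m'"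
  by (simp add: a_minus_def incl_add)

lemma incl_smult: "\<lbrakk>x \<in> carrier A; m \<in> carrier M\<rbrakk> \<Longrightarrow> \<iota> (x \<odot>\<^bsub>M\<^esub> m) = \<sigma> x \<otimes>\<^bsub>E\<^esub> \<iota> m"
  using incl_linear[of "\<sigma> x" m] by (simp add: sect_closed proj_sect)

lemma sect_zero: "\<sigma> \<zero>\<^bsub>A\<^esub> = \<zero>\<^bsub>E\<^esub>"
proof -
  have "\<sigma> \<zero>\<^bsub>A\<^esub> \<oplus>\<^bsub>E\<^esub> \<sigma> \<zero>\<^bsub>A\<^esub> = \<sigma> \<zero>\<^bsub>A\<^esub>"
    using sect_add[of "\<zero>\<^bsub>A\<^esub>" "\<zero>\<^bsub>A\<^esub>"] by simp
  then show ?thesis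
    using sect_closed[of "\<zero>\<^bsub>A\<^esub>"] by (metis A.zero_closed E.add.r_cancel_one')
qed

text \<open>The factor set of the extension relative to \<open>\<sigma>\<close>, a symmetric
  Hochschild 2-cocycle. \<open>inv_into\<close> is meaningful because the ring element lies in the
  image of \<open>\<iota>\<close>.\<close>

definition defect :: "'a \<Rightarrow> 'a \<Rightarrow> 'm" where
  "defect x y = inv_into (carrier M) \<iota> (\<sigma> x \<otimes>\<^bsub>E\<^esub> \<sigma> y \<ominus>\<^bsub>E\<^esub> \<sigma> (x \<otimes>\<^bsub>A\<^esub> y))"

lemma proj_minus: "\<lbrakk>e \<in> carrier E; e' \<in> carrier E\<rbrakk> \<Longrightarrow> \<pi> (e \<ominus>\<^bsub>E\<^esub> e') = \<pi> e \<ominus>\<^bsub>A\<^esub> \<pi> e'"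
  by (simp add: a_minus_def)

text \<open>\<open>\<pi>\<close> is multiplicative and inverts \<open>\<sigma>\<close>, so it sends
  both terms of the difference to the product of \<open>x\<close> and \<open>y\<close>.\<close>

lemma defect_props:
  assumes "x \<in> carrier A" "y \<in> carrier A"
  shows "defect x y \<in> carrier M" "\<iota> (defect x y) = \<sigma> x \<otimes>\<^bsub>E\<^esub> \<sigma> y \<ominus>\<^bsub>E\<^esub> \<sigma> (x \<otimes>\<^bsub>A\<^esub> y)"
proof -
  have "\<pi> (\<sigma> x \<otimes>\<^bsub>E\<^esub> \<sigma> y \<ominus>\<^bsub>E\<^esub> \<sigma> (x \<otimes>\<^bsub>A\<^esub> y)) = \<zero>\<^bsub>A\<^esub>"
    using assms by (simp add: proj_minus sect_closed proj_sect A.minus_eq A.r_neg)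
  then have "\<sigma> x \<otimes>\<^bsub>E\<^esub> \<sigma> y \<ominus>\<^bsub>E\<^esub> \<sigma> (x \<otimes>\<^bsub>A\<^esub> y) \<in> \<iota> ` carrier M"
    using assms bij_betw_imp_surj_on[OF incl_bij] by (simp add: in_kernel sect_closed)
  then show "defect x y \<in> carrier M" "\<iota> (defect x y) = \<sigma> x \<otimes>\<^bsub>E\<^esub> \<sigma> y \<ominus>\<^bsub>E\<^esub> \<sigma> (x \<otimes>\<^bsub>A\<^esub> y)"
    unfolding defect_def by (auto simp: inv_into_into f_inv_into_f)
qed

lemma defect_symmetric: "symmetric_on (carrier A) defect"
  by (simp add: symmetric_on_def defect_def A.m_comm E.m_comm sect_closed)

lemma defect_add_left:
  assumes "x \<in> carrier A" "x' \<in> carrier A" "y \<in> carrier A"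
  shows "defect (x \<oplus>\<^bsub>A\<^esub> x') y = defect x y \<oplus>\<^bsub>M\<^esub> defect x' y"
proof -
  \<comment> \<open>The sixth variable of \<open>defect_identities\<close> does not occur in this
    identity, so any element may fill it.\<close>
  have *: "(s \<oplus>\<^bsub>E\<^esub> t) \<otimes>\<^bsub>E\<^esub> u \<ominus>\<^bsub>E\<^esub> (v \<oplus>\<^bsub>E\<^esub> w) = (s \<otimes>\<^bsub>E\<^esub> u \<ominus>\<^bsub>E\<^esub> v) \<oplus>\<^bsub>E\<^esub> (t \<otimes>\<^bsub>E\<^esub> u \<ominus>\<^bsub>E\<^esub> w)"
    if "s \<in> carrier E" "t \<in> carrier E" "u \<in> carrier E" "v \<in> carrier E" "w \<in> carrier E" for s t u v w
    using that E.defect_identities(1)[of s t u v w u] by simp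
  show ?thesis
    using assms by (intro incl_inj) (simp_all add: defect_props incl_add sect_add sect_closed A.l_distr *)
qed

lemma defect_add_right:
  assumes "x \<in> carrier A" "y \<in> carrier A" "y' \<in> carrier A"
  shows "defect x (y \<oplus>\<^bsub>A\<^esub> y') = defect x y \<oplus>\<^bsub>M\<^esub> defect x y'"
  using assms defect_add_left[of y y' x] defect_symmetric by (simp add: symmetric_on_def)

text \<open>\<open>e\<close> plays the role of the image in \<open>E\<close> of a scalar of the base ring, for which \<open>\<sigma>\<close> is linear.\<close>

lemma defect_smult_left:
  assumes e: "e \<in> carrier E" and lin: "\<And>z. z \<in> carrier A \<Longrightarrow> \<sigma> (\<pi> e \<otimes>\<^bsub>A\<^esub> z) = e \<otimes>\<^bsub>E\<^esub> \<sigma> z"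
    and "x \<in> carrier A" "y \<in> carrier A"
  shows "defect (\<pi> e \<otimes>\<^bsub>A\<^esub> x) y = \<pi> e \<odot>\<^bsub>M\<^esub> defect x y"
proof -
  have *: "(g \<otimes>\<^bsub>E\<^esub> s) \<otimes>\<^bsub>E\<^esub> t \<ominus>\<^bsub>E\<^esub> g \<otimes>\<^bsub>E\<^esub> v = g \<otimes>\<^bsub>E\<^esub> (s \<otimes>\<^bsub>E\<^esub> t \<ominus>\<^bsub>E\<^esub> v)"
    if "g \<in> carrier E" "s \<in> carrier E" "t \<in> carrier E" "v \<in> carrier E" for g s t v
    using that E.defect_identities(2)[of s t g v v v] by simp
  show ?thesis
    using assms
    by (intro incl_inj) (simp_all add: defect_props incl_linear lin sect_closed A.m_assoc *)
qed

lemma defect_smult_right: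
  assumes "e \<in> carrier E" "\<And>z. z \<in> carrier A \<Longrightarrow> \<sigma> (\<pi> e \<otimes>\<^bsub>A\<^esub> z) = e \<otimes>\<^bsub>E\<^esub> \<sigma> z"
    and "x \<in> carrier A" "y \<in> carrier A"
  shows "defect x (\<pi> e \<otimes>\<^bsub>A\<^esub> y) = \<pi> e \<odot>\<^bsub>M\<^esub> defect x y"
  using assms defect_smult_left[of e y x] defect_symmetric by (simp add: symmetric_on_def)

text \<open>\<open>\<iota>\<close> turns the alternating sum into products of values of
  \<open>\<sigma>\<close>, which cancel in pairs. Commutativity of \<open>E\<close> lets the last
  factor be multiplied from the left.\<close>

lemma defect_cocycle: "cocycle A M defect"
  unfolding cocycle_def
proof (intro ballI)
  fix x y z assume c: "x \<in> carrier A" "y \<in> carrier A" "z \<in> carrier A"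
  \<comment> \<open>The variables \<open>s01\<close>, \<open>s12\<close> and \<open>s012\<close>
    stand for \<open>\<sigma>\<close> of the products xy, yz and xyz; associativity in
    \<open>A\<close> is what makes a single \<open>s012\<close> suffice.\<close>
  have *: "s0 \<otimes>\<^bsub>E\<^esub> (s1 \<otimes>\<^bsub>E\<^esub> s2 \<ominus>\<^bsub>E\<^esub> s12) \<ominus>\<^bsub>E\<^esub> (s01 \<otimes>\<^bsub>E\<^esub> s2 \<ominus>\<^bsub>E\<^esub> s012) \<oplus>\<^bsub>E\<^esub>
      (s0 \<otimes>\<^bsub>E\<^esub> s12 \<ominus>\<^bsub>E\<^esub> s012) \<ominus>\<^bsub>E\<^esub> s2 \<otimes>\<^bsub>E\<^esub> (s0 \<otimes>\<^bsub>E\<^esub> s1 \<ominus>\<^bsub>E\<^esub> s01) = \<zero>\<^bsub>E\<^esub>"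
    if "s0 \<in> carrier E" "s1 \<in> carrier E" "s2 \<in> carrier E" "s01 \<in> carrier E" "s12 \<in> carrier E"
      "s012 \<in> carrier E" for s0 s1 s2 s01 s12 s012
    using that E.defect_identities(3)[of s0 s1 s2 s01 s12 s012] by simp
  show "x \<odot>\<^bsub>M\<^esub> defect y z \<ominus>\<^bsub>M\<^esub> defect (x \<otimes>\<^bsub>A\<^esub> y) z \<oplus>\<^bsub>M\<^esub> defect x (y \<otimes>\<^bsub>A\<^esub> z) \<ominus>\<^bsub>M\<^esub>
      z \<odot>\<^bsub>M\<^esub> defect x y = \<zero>\<^bsub>M\<^esub>"
    using c by (intro incl_inj)
      (simp_all add: defect_props incl_add incl_minus incl_smult sect_closed A.m_assoc *)
qed

section \<open>The splitting as a ring isomorphism from the twisted product\<close>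

definition splitting :: "'a \<times> 'm \<Rightarrow> 'e" where
  "splitting = (\<lambda>(x, m). \<sigma> x \<oplus>\<^bsub>E\<^esub> \<iota> m)"

lemma splitting_closed: "\<lbrakk>x \<in> carrier A; m \<in> carrier M\<rbrakk> \<Longrightarrow> splitting (x, m) \<in> carrier E"
  by (simp add: splitting_def sect_closed incl_closed)

lemma proj_splitting: "\<lbrakk>x \<in> carrier A; m \<in> carrier M\<rbrakk> \<Longrightarrow> \<pi> (splitting (x, m)) = x"
  by (simp add: splitting_def sect_closed incl_closed proj_sect proj_incl)

lemma splitting_zero: "m \<in> carrier M \<Longrightarrow> splitting (\<zero>\<^bsub>A\<^esub>, m) = \<iota> m"
  by (simp add: splitting_def sect_zero incl_closed)

lemma splitting_add:
  "\<lbrakk>x \<in> carrier A; m \<in> carrier M; x' \<in> carrier A; m' \<in> carrier M\<rbrakk>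
   \<Longrightarrow> splitting (x \<oplus>\<^bsub>A\<^esub> x', m \<oplus>\<^bsub>M\<^esub> m') = splitting (x, m) \<oplus>\<^bsub>E\<^esub> splitting (x', m')"
  by (simp add: splitting_def sect_add incl_add sect_closed incl_closed E.a_ac)

lemma splitting_smult:
  assumes "e \<in> carrier E" "\<And>z. z \<in> carrier A \<Longrightarrow> \<sigma> (\<pi> e \<otimes>\<^bsub>A\<^esub> z) = e \<otimes>\<^bsub>E\<^esub> \<sigma> z"
    and "x \<in> carrier A" "m \<in> carrier M"
  shows "splitting (\<pi> e \<otimes>\<^bsub>A\<^esub> x, \<pi> e \<odot>\<^bsub>M\<^esub> m) = e \<otimes>\<^bsub>E\<^esub> splitting (x, m)"
  using assms by (simp add: splitting_def incl_linear sect_closed incl_closed E.r_distr)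

lemma splitting_bij: "bij_betw splitting (carrier A \<times> carrier M) (carrier E)"
  unfolding bij_betw_def
proof
  show "inj_on splitting (carrier A \<times> carrier M)"
  proof (rule inj_onI, clarify)
    fix x m x' m'
    assume c: "x \<in> carrier A" "m \<in> carrier M" "x' \<in> carrier A" "m' \<in> carrier M"
      and eq: "splitting (x, m) = splitting (x', m')"
    then have x: "x = x'" using proj_splitting by metis
    with eq c have "\<iota> m = \<iota> m'"
      by (simp add: splitting_def sect_closed incl_closed)
    with x c show "x = x' \<and> m = m'" using incl_inj by blast
  qed
  show "splitting ` (carrier A \<times> carrier M) = carrier E"
  proof (intro subset_antisym subsetI)
    fix e assume "e \<in> splitting ` (carrier A \<times> carrier M)"
    then show "e \<in> carrier E" using splitting_closed by auto
  next
    fix e assume e: "e \<in> carrier E"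
    have s: "\<sigma> (\<pi> e) \<in> carrier E" using e by (simp add: sect_closed)
    \<comment> \<open>The inverse sends \<open>e\<close> to \<open>\<pi> e\<close> together with the
      element of \<open>M\<close> corresponding to this difference.\<close>
    have "e \<ominus>\<^bsub>E\<^esub> \<sigma> (\<pi> e) \<in> a_kernel E A \<pi>"
      using e s by (simp add: in_kernel proj_minus proj_sect A.minus_eq A.r_neg)
    then obtain m where m: "m \<in> carrier M" "\<iota> m = e \<ominus>\<^bsub>E\<^esub> \<sigma> (\<pi> e)"
      using bij_betw_imp_surj_on[OF incl_bij] by (metis image_iff)
    have "\<sigma> (\<pi> e) \<oplus>\<^bsub>E\<^esub> (e \<ominus>\<^bsub>E\<^esub> \<sigma> (\<pi> e)) = e"
      using E.defect_identities(5) e s by blast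
    then have "e = splitting (\<pi> e, m)" by (simp add: splitting_def m)
    then show "e \<in> splitting ` (carrier A \<times> carrier M)"
      by (rule image_eqI) (simp add: e m)
  qed
qed

text \<open>This is where the multiplication formula comes from. Expanding the product of two sums,
  the cross terms are the module actions, the product of the two kernel elements vanishes, and the
  product of the sections exceeds the section of the product by the defect.\<close>

lemma splitting_mult:
  assumes c: "x \<in> carrier A" "m \<in> carrier M" "y \<in> carrier A" "n \<in> carrier M"
  shows "splitting (x \<otimes>\<^bsub>A\<^esub> y, ((x \<odot>\<^bsub>M\<^esub> n) \<oplus>\<^bsub>M\<^esub> (y \<odot>\<^bsub>M\<^esub> m)) \<oplus>\<^bsub>M\<^esub> defect x y)
    = splitting (x, m) \<otimes>\<^bsub>E\<^esub> splitting (y, n)"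
proof -
  have *: "(s \<oplus>\<^bsub>E\<^esub> v) \<otimes>\<^bsub>E\<^esub> (t \<oplus>\<^bsub>E\<^esub> w)
      = u \<oplus>\<^bsub>E\<^esub> ((s \<otimes>\<^bsub>E\<^esub> w) \<oplus>\<^bsub>E\<^esub> (t \<otimes>\<^bsub>E\<^esub> v) \<oplus>\<^bsub>E\<^esub> (s \<otimes>\<^bsub>E\<^esub> t \<ominus>\<^bsub>E\<^esub> u)) \<oplus>\<^bsub>E\<^esub> v \<otimes>\<^bsub>E\<^esub> w"
    if "s \<in> carrier E" "t \<in> carrier E" "u \<in> carrier E" "v \<in> carrier E" "w \<in> carrier E" for s t u v w
    using that E.defect_identities(4)[of s t u v w u] by simp
  have "\<iota> m \<otimes>\<^bsub>E\<^esub> \<iota> n = \<zero>\<^bsub>E\<^esub>"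
    using c by (simp add: kernel_square_zero incl_kernel)
  then show ?thesis
    using c *[of "\<sigma> x" "\<sigma> y" "\<sigma> (x \<otimes>\<^bsub>A\<^esub> y)" "\<iota> m" "\<iota> n"]
    by (simp add: splitting_def incl_add incl_smult defect_props sect_closed incl_closed)
qed

text \<open>The element \<open>\<sigma> 1 - 1\<close> lies in the kernel, so its square vanishes; hence \<open>2 \<sigma> 1 - (\<sigma> 1)\<^sup>2 = 1\<close>.\<close>

lemma splitting_one: "splitting (\<one>\<^bsub>A\<^esub>, \<ominus>\<^bsub>M\<^esub> defect \<one>\<^bsub>A\<^esub> \<one>\<^bsub>A\<^esub>) = \<one>\<^bsub>E\<^esub>"
proof -
  let ?s = "\<sigma> \<one>\<^bsub>A\<^esub>"
  have s: "?s \<in> carrier E" by (simp add: sect_closed)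
  have "?s \<ominus>\<^bsub>E\<^esub> \<one>\<^bsub>E\<^esub> \<in> a_kernel E A \<pi>"
    using s by (simp add: in_kernel proj_minus proj_sect A.minus_eq A.r_neg)
  then have sq: "(?s \<ominus>\<^bsub>E\<^esub> \<one>\<^bsub>E\<^esub>) \<otimes>\<^bsub>E\<^esub> (?s \<ominus>\<^bsub>E\<^esub> \<one>\<^bsub>E\<^esub>) = \<zero>\<^bsub>E\<^esub>"
    by (simp add: kernel_square_zero)
  have "splitting (\<one>\<^bsub>A\<^esub>, \<ominus>\<^bsub>M\<^esub> defect \<one>\<^bsub>A\<^esub> \<one>\<^bsub>A\<^esub>) = ?s \<oplus>\<^bsub>E\<^esub> \<ominus>\<^bsub>E\<^esub> (?s \<otimes>\<^bsub>E\<^esub> ?s \<ominus>\<^bsub>E\<^esub> ?s)"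
    by (simp add: splitting_def defect_props)
  also have "\<dots> = \<one>\<^bsub>E\<^esub> \<ominus>\<^bsub>E\<^esub> (?s \<ominus>\<^bsub>E\<^esub> \<one>\<^bsub>E\<^esub>) \<otimes>\<^bsub>E\<^esub> (?s \<ominus>\<^bsub>E\<^esub> \<one>\<^bsub>E\<^esub>)"
    using E.defect_identities(6) s by blast
  also have "\<dots> = \<one>\<^bsub>E\<^esub>"
    unfolding sq by (simp add: E.minus_eq)
  finally show ?thesis .
qed

text \<open>Stated for any \<open>b\<close> equal to the defect on the carrier, because the values
  of f on tensors are known only for arguments there.\<close>

lemma twisted_ring_iso:
  assumes b: "\<And>x y. \<lbrakk>x \<in> carrier A; y \<in> carrier A\<rbrakk> \<Longrightarrow> b x y = defect x y"
  shows "cring (twisted_ring A M b)" "splitting \<in> ring_iso (twisted_ring A M b) E"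
proof -
  let ?S = "twisted_ring A M b"
  have bij: "bij_betw splitting (carrier ?S) (carrier E)"
    by (simp add: splitting_bij)
  have add: "p \<oplus>\<^bsub>?S\<^esub> q \<in> carrier ?S" "splitting (p \<oplus>\<^bsub>?S\<^esub> q) = splitting p \<oplus>\<^bsub>E\<^esub> splitting q"
    if "p \<in> carrier ?S" "q \<in> carrier ?S" for p q
    using that by (auto simp: splitting_add)
  have mult: "p \<otimes>\<^bsub>?S\<^esub> q \<in> carrier ?S" "splitting (p \<otimes>\<^bsub>?S\<^esub> q) = splitting p \<otimes>\<^bsub>E\<^esub> splitting q"
    if "p \<in> carrier ?S" "q \<in> carrier ?S" for p q
    using that by (auto simp: b defect_props splitting_mult)
  have zero: "\<zero>\<^bsub>?S\<^esub> \<in> carrier ?S" "splitting \<zero>\<^bsub>?S\<^esub> = \<zero>\<^bsub>E\<^esub>"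
    by (simp_all add: splitting_zero)
  have one: "\<one>\<^bsub>?S\<^esub> \<in> carrier ?S" "splitting \<one>\<^bsub>?S\<^esub> = \<one>\<^bsub>E\<^esub>"
    using splitting_one by (simp_all add: b defect_props)
  show "cring ?S" "splitting \<in> ring_iso ?S E"
    by (rule cring_pullback[OF E.cring_axioms bij add(1) mult(1) zero(1) one(1) add(2) mult(2) zero(2) one(2)];
        assumption)+
qed

end


section \<open>Split infinitesimal extensions\<close>

lemma with_smult_simps [simp]:
  "carrier (with_smult M sm) = carrier M" "add (with_smult M sm) = add M"
  "\<zero>\<^bsub>with_smult M sm\<^esub> = \<zero>\<^bsub>M\<^esub>" "smult (with_smult M sm) = sm"
  by (simp_all add: with_smult_def)

lemma abelian_group_with_smult:
  assumes "abelian_group M"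
  shows "abelian_group (with_smult M sm)"
proof -
  interpret abelian_group M by fact
  have "\<exists>y \<in> carrier M. y \<oplus>\<^bsub>M\<^esub> x = \<zero>\<^bsub>M\<^esub>" if "x \<in> carrier M" for x
    using that l_neg by blast
  then show ?thesis
    by (intro abelian_groupI) (auto simp: a_ac)
qed

lemma module_of_ring_hom:
  assumes "cring R" "cring B" "\<phi> \<in> ring_hom R B"
  shows "Module.module R (with_smult B (\<lambda>r s. \<phi> r \<otimes>\<^bsub>B\<^esub> s))"
proof -
  interpret R: cring R by fact
  interpret B: cring B by fact
  note [simp] = ring_hom_closed[OF assms(3)] ring_hom_add[OF assms(3)] ring_hom_mult[OF assms(3)]
    ring_hom_one[OF assms(3)]
  show ?thesis
    by (rule moduleI)
      (auto simp: B.l_distr B.r_distr B.m_assoc R.cring_axioms intro: abelian_group_with_smult B.abelian_group_axioms)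
qed

lemma module_restrict_scalars:
  assumes "cring R" "Module.module A M" "\<phi> \<in> ring_hom R A"
  shows "Module.module R (with_smult M (\<lambda>r s. \<phi> r \<odot>\<^bsub>M\<^esub> s))"
proof -
  interpret R: cring R by fact
  interpret M: Module.module A M by fact
  note [simp] = ring_hom_closed[OF assms(3)] ring_hom_add[OF assms(3)] ring_hom_mult[OF assms(3)]
    ring_hom_one[OF assms(3)]
  show ?thesis
    by (rule moduleI)
      (auto simp: M.smult_l_distr M.smult_r_distr M.smult_assoc1 R.cring_axioms
        intro: abelian_group_with_smult M.abelian_group_axioms)
qed

lemma algebra_sheaf_simps [simp]:
  "sections (algebra_sheaf \<phi> \<B>) U = with_smult (sections \<B> U) (\<lambda>r s. \<phi> U r \<otimes>\<^bsub>sections \<B> U\<^esub> s)"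
  "restr (algebra_sheaf \<phi> \<B>) = restr \<B>"
  by (simp_all add: algebra_sheaf_def)

lemma restrict_scalars_simps [simp]:
  "sections (restrict_scalars \<phi> F) U = with_smult (sections F U) (\<lambda>r s. \<phi> U r \<odot>\<^bsub>sections F U\<^esub> s)"
  "restr (restrict_scalars \<phi> F) = restr F"
  by (simp_all add: restrict_scalars_def)

lemma tensor_presheaf_simps [simp]:
  "sections (tensor_presheaf \<O> F G) U = tensor_module (sections \<O> U) (sections F U) (sections G U)"
  "restr (tensor_presheaf \<O> F G) U V = tensor_map (sections \<O> V) (sections F V) (sections G V)
     (restr F U V) (restr G U V)"
  by (simp_all add: tensor_presheaf_def)

lemma ring_sheaf_homD:
  assumes "ring_sheaf_hom T \<A> \<B> \<phi>" "openin T U"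
  shows "\<phi> U \<in> ring_hom (sections \<A> U) (sections \<B> U)"
    and "\<lbrakk>openin T V; V \<subseteq> U; s \<in> carrier (sections \<A> U)\<rbrakk>
      \<Longrightarrow> \<phi> V (restr \<A> U V s) = restr \<B> U V (\<phi> U s)"
  using assms unfolding ring_sheaf_hom_def natural_map_def by blast+

text \<open>Sections and restriction maps stay the same, so locality and gluing carry over verbatim.
  Naturality of \<open>\<phi>\<close> makes the new scalar multiplication commute with
  restriction.\<close>

lemma module_sheaf_restrict_scalars:
  assumes "ringed_space T \<O>" "module_sheaf T \<A> F" "ring_sheaf_hom T \<O> \<A> \<phi>"
  shows "module_sheaf T \<O> (restrict_scalars \<phi> F)"
proof -
  interpret O: ringed_space T \<O> by fact
  interpret F: module_sheaf T \<A> F by fact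
  have "sheaf T (restrict_scalars \<phi> F)"
  proof (rule sheaf.intro, goal_cases)
    case (4 \<U> s t)
    then show ?case
      unfolding restrict_scalars_simps with_smult_simps by (rule F.locality)
  next
    case (5 \<U> c)
    then show ?case
      unfolding restrict_scalars_simps with_smult_simps by (rule F.gluing)
  qed (simp_all add: F.restr_closed F.restr_id F.restr_comp)
  moreover have "module_sheaf_axioms T \<O> (restrict_scalars \<phi> F)"
  proof (rule module_sheaf_axioms.intro)
    fix U assume U: "openin T U"
    show "Module.module (sections \<O> U) (sections (restrict_scalars \<phi> F) U)"
      using module_restrict_scalars[OF O.sections_cring F.sections_module] ring_sheaf_homD(1)[OF assms(3)] U
      by simp
  next
    fix U V a s
    assume "openin T U" "openin T V" "V \<subseteq> U" "a \<in> carrier (sections \<O> U)"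
      "s \<in> carrier (sections (restrict_scalars \<phi> F) U)"
    then show "restr (restrict_scalars \<phi> F) U V (a \<odot>\<^bsub>sections (restrict_scalars \<phi> F) U\<^esub> s) =
        restr \<O> U V a \<odot>\<^bsub>sections (restrict_scalars \<phi> F) V\<^esub> restr (restrict_scalars \<phi> F) U V s"
      using ring_sheaf_homD[OF assms(3)] ring_hom_closed[OF ring_sheaf_homD(1)[OF assms(3)]]
      by (simp add: F.restr_smult)
  qed (simp add: F.restr_add)
  ultimately show ?thesis
    by (simp add: module_sheaf_def O.ringed_space_axioms)
qed

section \<open>From rings to sheaves\<close>

text \<open>Fixes one section \<open>\<sigma>\<close>, so that the definitions below may depend on
  it. Scalars act on the extension through \<open>g\<close> and on the quotient through
  \<open>h\<close>; \<open>proj_g\<close> expresses the factorisation of the morphism.\<close>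

locale split_infinitesimal_extension =
  infinitesimal_extension T \<O>\<^sub>Y F \<O>\<^sub>X \<pi> \<iota> + F: module_sheaf T \<O>\<^sub>Y F + Z: ringed_space T \<O>\<^sub>Z
  for T :: "'p topology" and \<O>\<^sub>Y :: "('p, 'y) ring_presheaf" and F :: "('p, 'y, 'm) module_presheaf"
    and \<O>\<^sub>X :: "('p, 'x) ring_presheaf" and \<pi> :: "'p set \<Rightarrow> 'x \<Rightarrow> 'y" and \<iota> :: "'p set \<Rightarrow> 'm \<Rightarrow> 'x"
    and \<O>\<^sub>Z :: "('p, 'z) ring_presheaf" +
  fixes h :: "'p set \<Rightarrow> 'z \<Rightarrow> 'y" and g :: "'p set \<Rightarrow> 'z \<Rightarrow> 'x" and \<sigma> :: "'p set \<Rightarrow> 'y \<Rightarrow> 'x"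
  assumes h_hom: "ring_sheaf_hom T \<O>\<^sub>Z \<O>\<^sub>Y h" and g_hom: "ring_sheaf_hom T \<O>\<^sub>Z \<O>\<^sub>X g"
    and proj_g: "\<lbrakk>openin T U; s \<in> carrier (sections \<O>\<^sub>Z U)\<rbrakk> \<Longrightarrow> \<pi> U (g U s) = h U s"
    and sect_hom: "module_sheaf_hom T \<O>\<^sub>Z (algebra_sheaf h \<O>\<^sub>Y) (algebra_sheaf g \<O>\<^sub>X) \<sigma>"
    and proj_sect: "\<lbrakk>openin T U; y \<in> carrier (sections \<O>\<^sub>Y U)\<rbrakk> \<Longrightarrow> \<pi> U (\<sigma> U y) = y"
begin

lemma sect_closed: "\<lbrakk>openin T U; y \<in> carrier (sections \<O>\<^sub>Y U)\<rbrakk> \<Longrightarrow> \<sigma> U y \<in> carrier (sections \<O>\<^sub>X U)"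
  and sect_add: "\<lbrakk>openin T U; y \<in> carrier (sections \<O>\<^sub>Y U); y' \<in> carrier (sections \<O>\<^sub>Y U)\<rbrakk>
    \<Longrightarrow> \<sigma> U (y \<oplus>\<^bsub>sections \<O>\<^sub>Y U\<^esub> y') = \<sigma> U y \<oplus>\<^bsub>sections \<O>\<^sub>X U\<^esub> \<sigma> U y'"
  and sect_linear: "\<lbrakk>openin T U; r \<in> carrier (sections \<O>\<^sub>Z U); y \<in> carrier (sections \<O>\<^sub>Y U)\<rbrakk>
    \<Longrightarrow> \<sigma> U (h U r \<otimes>\<^bsub>sections \<O>\<^sub>Y U\<^esub> y) = g U r \<otimes>\<^bsub>sections \<O>\<^sub>X U\<^esub> \<sigma> U y"
  and sect_natural: "\<lbrakk>openin T U; openin T V; V \<subseteq> U; y \<in> carrier (sections \<O>\<^sub>Y U)\<rbrakk>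
    \<Longrightarrow> \<sigma> V (restr \<O>\<^sub>Y U V y) = restr \<O>\<^sub>X U V (\<sigma> U y)"
  using sect_hom by (auto simp: module_sheaf_hom_def linear_maps_def natural_map_def)

lemma g_closed: "\<lbrakk>openin T U; r \<in> carrier (sections \<O>\<^sub>Z U)\<rbrakk> \<Longrightarrow> g U r \<in> carrier (sections \<O>\<^sub>X U)"
  using ring_hom_closed[OF ring_sheaf_homD(1)[OF g_hom]] .

text \<open>Kernels of sheaf maps are computed on sections, and \<open>\<sigma>\<close> gives
  surjectivity on sections, so each open set carries a split extension of rings.\<close>

lemma local_extension:
  assumes "openin T U"
  shows "split_square_zero_extension (sections \<O>\<^sub>Y U) (sections \<O>\<^sub>X U) (sections F U) (\<pi> U) (\<iota> U) (\<sigma> U)"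
  using assms
  by (intro split_square_zero_extension.intro split_square_zero_extension_axioms.intro
      F.base.sections_cring X.sections_cring F.sections_module ring_sheaf_homD(1)[OF proj_hom]
      square_zero incl_bij incl_add incl_linear sect_closed sect_add proj_sect)

definition local_cocycle :: "'p set \<Rightarrow> 'y \<Rightarrow> 'y \<Rightarrow> 'm" where
  "local_cocycle U = split_square_zero_extension.defect (sections \<O>\<^sub>Y U) (sections \<O>\<^sub>X U) (sections F U) (\<iota> U) (\<sigma> U)"

definition \<Phi> :: "'p set \<Rightarrow> 'y \<times> 'm \<Rightarrow> 'x" where
  "\<Phi> U = split_square_zero_extension.splitting (sections \<O>\<^sub>X U) (\<iota> U) (\<sigma> U)"

abbreviation "Alg \<equiv> algebra_sheaf h \<O>\<^sub>Y"
abbreviation "F\<^sub>Z \<equiv> restrict_scalars h F"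
abbreviation "presheaf_cocycle \<equiv> \<lambda>U. tensor_lift (sections Alg U) (sections Alg U) (sections F\<^sub>Z U) (local_cocycle U)"

definition sheaf_cocycle :: "'p set \<Rightarrow> ('p \<Rightarrow> ('p set \<times> ('y \<times> 'y \<Rightarrow>\<^sub>0 int) set) set) \<Rightarrow> 'm" where
  "sheaf_cocycle = sheafify_lift T F\<^sub>Z presheaf_cocycle"

lemma splitting_iso: "module_sheaf_iso T \<O>\<^sub>Z (direct_sum Alg F\<^sub>Z) (algebra_sheaf g \<O>\<^sub>X) \<Phi>"
proof -
  have nat: "\<Phi> V (restr \<O>\<^sub>Y U V x, restr F U V m) = restr \<O>\<^sub>X U V (\<Phi> U (x, m))"
    if o: "openin T U" "openin T V" "V \<subseteq> U" and c: "x \<in> carrier (sections \<O>\<^sub>Y U)" "m \<in> carrier (sections F U)"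
    for U V x m
  proof -
    interpret U: split_square_zero_extension "sections \<O>\<^sub>Y U" "sections \<O>\<^sub>X U" "sections F U" "\<pi> U" "\<iota> U" "\<sigma> U"
      by (rule local_extension[OF o(1)])
    interpret V: split_square_zero_extension "sections \<O>\<^sub>Y V" "sections \<O>\<^sub>X V" "sections F V" "\<pi> V" "\<iota> V" "\<sigma> V"
      by (rule local_extension[OF o(2)])
    have "\<iota> V (restr F U V m) = restr \<O>\<^sub>X U V (\<iota> U m)"
      using incl_natural o c by (simp add: natural_map_def)
    then show ?thesis
      using o c by (simp add: \<Phi>_def U.splitting_def V.splitting_def sect_natural
          ring_hom_add[OF X.restr_ring_hom] sect_closed U.incl_closed)
  qed
  have lin: "\<Phi> U \<in> linear_maps (sections \<O>\<^sub>Z U) (sections (direct_sum Alg F\<^sub>Z) U) (sections (algebra_sheaf g \<O>\<^sub>X) U)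
      \<and> bij_betw (\<Phi> U) (carrier (sections (direct_sum Alg F\<^sub>Z) U)) (carrier (sections (algebra_sheaf g \<O>\<^sub>X) U))"
    if U: "openin T U" for U
  proof -
    interpret U: split_square_zero_extension "sections \<O>\<^sub>Y U" "sections \<O>\<^sub>X U" "sections F U" "\<pi> U" "\<iota> U" "\<sigma> U"
      by (rule local_extension[OF U])
    \<comment> \<open>The ring-level lemma is applied with \<open>e = g U r\<close>: its image under
      \<open>\<pi>\<close> is \<open>h U r\<close>, and \<open>sect_linear\<close> is the required
      linearity.\<close>
    have smult: "U.splitting (h U r \<otimes>\<^bsub>sections \<O>\<^sub>Y U\<^esub> x, h U r \<odot>\<^bsub>sections F U\<^esub> m)
        = g U r \<otimes>\<^bsub>sections \<O>\<^sub>X U\<^esub> U.splitting (x, m)"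
      if "r \<in> carrier (sections \<O>\<^sub>Z U)" "x \<in> carrier (sections \<O>\<^sub>Y U)" "m \<in> carrier (sections F U)" for r x m
      using U.splitting_smult[of "g U r" x m] that U by (simp add: g_closed proj_g sect_linear)
    show ?thesis
      by (auto simp: \<Phi>_def linear_maps_def direct_sum_def U.splitting_bij U.splitting_closed U.splitting_add smult)
  qed
  show ?thesis
    unfolding module_sheaf_iso_def module_sheaf_hom_def natural_map_def
    using nat lin by (auto simp: direct_sum_def)
qed

lemma algebra_module: "openin T U \<Longrightarrow> Module.module (sections \<O>\<^sub>Z U) (sections Alg U)"
  using module_of_ring_hom[OF Z.sections_cring F.base.sections_cring ring_sheaf_homD(1)[OF h_hom]] by simp

lemma local_cocycle_bilinear:
  assumes U: "openin T U"
  shows "bilinear_map (sections \<O>\<^sub>Z U) (sections Alg U) (sections Alg U) (sections F\<^sub>Z U) (local_cocycle U)"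
proof -
  interpret U: split_square_zero_extension "sections \<O>\<^sub>Y U" "sections \<O>\<^sub>X U" "sections F U" "\<pi> U" "\<iota> U" "\<sigma> U"
    by (rule local_extension[OF U])
  have "Module.module (sections \<O>\<^sub>Z U) (sections F\<^sub>Z U)"
    using module_restrict_scalars[OF Z.sections_cring F.sections_module ring_sheaf_homD(1)[OF h_hom]] U by simp
  moreover have "U.defect (h U r \<otimes>\<^bsub>sections \<O>\<^sub>Y U\<^esub> x) y = h U r \<odot>\<^bsub>sections F U\<^esub> U.defect x y"
    "U.defect x (h U r \<otimes>\<^bsub>sections \<O>\<^sub>Y U\<^esub> y) = h U r \<odot>\<^bsub>sections F U\<^esub> U.defect x y"
    if "r \<in> carrier (sections \<O>\<^sub>Z U)" "x \<in> carrier (sections \<O>\<^sub>Y U)" "y \<in> carrier (sections \<O>\<^sub>Y U)" for r x y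
    using U.defect_smult_left[of "g U r" x y] U.defect_smult_right[of "g U r" x y] that U
    by (simp_all add: g_closed proj_g sect_linear)
  ultimately show ?thesis
    using algebra_module[OF U]
    by (simp add: bilinear_map_def bilinear_map_axioms_def module_pair_def local_cocycle_def
        U.defect_props U.defect_add_left U.defect_add_right)
qed

text \<open>Restriction commutes with \<open>\<sigma>\<close>, with products and with
  \<open>\<iota>\<close>; injectivity of \<open>\<iota> V\<close> brings the equality back to
  \<open>F\<close>.\<close>

lemma local_cocycle_natural:
  assumes o: "openin T U" "openin T V" "V \<subseteq> U"
    and c: "x \<in> carrier (sections \<O>\<^sub>Y U)" "y \<in> carrier (sections \<O>\<^sub>Y U)"
  shows "local_cocycle V (restr \<O>\<^sub>Y U V x) (restr \<O>\<^sub>Y U V y) = restr F U V (local_cocycle U x y)"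
proof -
  interpret U: split_square_zero_extension "sections \<O>\<^sub>Y U" "sections \<O>\<^sub>X U" "sections F U" "\<pi> U" "\<iota> U" "\<sigma> U"
    by (rule local_extension[OF o(1)])
  interpret V: split_square_zero_extension "sections \<O>\<^sub>Y V" "sections \<O>\<^sub>X V" "sections F V" "\<pi> V" "\<iota> V" "\<sigma> V"
    by (rule local_extension[OF o(2)])
  interpret RX: ring_hom_cring "sections \<O>\<^sub>X U" "sections \<O>\<^sub>X V" "restr \<O>\<^sub>X U V"
    using X.restr_ring_hom[OF o] by unfold_locales
  note ry = F.base.restr_closed[OF o] and rmult = ring_hom_mult[OF F.base.restr_ring_hom[OF o]]
  have "\<iota> V (restr F U V (U.defect x y)) = restr \<O>\<^sub>X U V (\<iota> U (U.defect x y))"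
    using incl_natural o c by (simp add: natural_map_def U.defect_props)
  \<comment> \<open>The product of restrictions must first become the restriction of a product,
    hence \<open>rmult\<close> from right to left, before \<open>sect_natural\<close> can move it
    past \<open>\<sigma>\<close>.\<close>
  also have "\<dots> = \<iota> V (V.defect (restr \<O>\<^sub>Y U V x) (restr \<O>\<^sub>Y U V y))"
    using o c by (simp add: U.defect_props V.defect_props ry a_minus_def sect_closed sect_natural
        flip: rmult)
  finally show ?thesis
    unfolding local_cocycle_def using o c
    by (intro V.incl_inj[symmetric]) (simp_all add: F.restr_closed U.defect_props V.defect_props ry)
qed

lemma restr_module_pair_map:
  assumes o: "openin T U" "openin T V" "V \<subseteq> U"
  shows "module_pair_map (sections \<O>\<^sub>Z U) (sections Alg U) (sections Alg U)
    (sections \<O>\<^sub>Z V) (sections Alg V) (sections Alg V) (restr \<O>\<^sub>Z U V) (restr \<O>\<^sub>Y U V) (restr \<O>\<^sub>Y U V)"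
proof -
  have "restr \<O>\<^sub>Y U V (h U r \<otimes>\<^bsub>sections \<O>\<^sub>Y U\<^esub> y) = h V (restr \<O>\<^sub>Z U V r) \<otimes>\<^bsub>sections \<O>\<^sub>Y V\<^esub> restr \<O>\<^sub>Y U V y"
    if "r \<in> carrier (sections \<O>\<^sub>Z U)" "y \<in> carrier (sections \<O>\<^sub>Y U)" for r y
    using that o ring_hom_mult[OF F.base.restr_ring_hom[OF o]] ring_sheaf_homD[OF h_hom o(1)]
      ring_hom_closed[OF ring_sheaf_homD(1)[OF h_hom o(1)]]
    by simp
  then show ?thesis
    using algebra_module o ring_hom_add[OF F.base.restr_ring_hom[OF o]]
    by (simp add: module_pair_map_def module_pair_map_axioms_def module_pair_def
        Z.restr_closed F.base.restr_closed)
qed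

text \<open>Joins the two universal properties: the bilinear maps induce a morphism of presheaves,
  natural by \<open>tensor_lift_natural\<close> with \<open>\<theta>\<close> the restriction of
  \<open>F\<close>, and this is the input for the extension to the sheafification.\<close>

sublocale f: presheaf_to_sheaf T \<O>\<^sub>Z F\<^sub>Z "tensor_presheaf \<O>\<^sub>Z Alg Alg" presheaf_cocycle
proof -
  have pair: "module_pair (sections \<O>\<^sub>Z U) (sections Alg U) (sections Alg U)" if "openin T U" for U
    using algebra_module[OF that] by (simp add: module_pair_def)
  have "module_sheaf T \<O>\<^sub>Z F\<^sub>Z"
    by (rule module_sheaf_restrict_scalars[OF Z.ringed_space_axioms F.module_sheaf_axioms h_hom])
  moreover have "natural_map T (tensor_presheaf \<O>\<^sub>Z Alg Alg) F\<^sub>Z presheaf_cocycle"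
    unfolding natural_map_def
  proof (intro allI impI)
    fix U V C
    assume o: "openin T U" "openin T V" "V \<subseteq> U"
      and C: "C \<in> carrier (sections (tensor_presheaf \<O>\<^sub>Z Alg Alg) U)"
    have C': "C \<in> carrier (tensor_module (sections \<O>\<^sub>Z U) (sections Alg U) (sections Alg U))"
      using C by (simp only: tensor_presheaf_simps)
    have "tensor_lift (sections Alg V) (sections Alg V) (sections F\<^sub>Z V) (local_cocycle V)
        (tensor_map (sections \<O>\<^sub>Z V) (sections Alg V) (sections Alg V) (restr \<O>\<^sub>Y U V) (restr \<O>\<^sub>Y U V) C)
        = restr F U V (tensor_lift (sections Alg U) (sections Alg U) (sections F\<^sub>Z U) (local_cocycle U) C)"
      by (rule tensor_lift_natural[OF local_cocycle_bilinear[OF o(1)] local_cocycle_bilinear[OF o(2)]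
            restr_module_pair_map[OF o] _ _ _ C'])
        (use o in \<open>simp_all add: F.restr_closed F.restr_add local_cocycle_natural\<close>)
    then show "presheaf_cocycle V (restr (tensor_presheaf \<O>\<^sub>Z Alg Alg) U V C) = restr F\<^sub>Z U V (presheaf_cocycle U C)"
      by simp
  qed
  moreover have "presheaf_cocycle U \<in> linear_maps (sections \<O>\<^sub>Z U) (sections (tensor_presheaf \<O>\<^sub>Z Alg Alg) U) (sections F\<^sub>Z U)"
    if "openin T U" for U
    using bilinear_map.tensor_lift_closed[OF local_cocycle_bilinear[OF that]]
      bilinear_map.tensor_lift_add[OF local_cocycle_bilinear[OF that]]
      bilinear_map.tensor_lift_smult[OF local_cocycle_bilinear[OF that]]
    by (simp add: linear_maps_def)
  ultimately show "presheaf_to_sheaf T \<O>\<^sub>Z F\<^sub>Z (tensor_presheaf \<O>\<^sub>Z Alg Alg) presheaf_cocycle"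
    using module_pair_map.tensor_map_closed[OF restr_module_pair_map]
      module_pair.tensor_add_closed[OF pair] module_pair.tensor_smult_closed[OF pair]
    by (simp add: presheaf_to_sheaf_def presheaf_to_sheaf_axioms_def module_sheaf_hom_def)
qed

lemma sheaf_cocycle_hom: "module_sheaf_hom T \<O>\<^sub>Z (tensor_sheaf T \<O>\<^sub>Z Alg Alg) F\<^sub>Z sheaf_cocycle"
  unfolding tensor_sheaf_def sheaf_cocycle_def by (rule f.sheafify_lift_hom)

lemma simple_tensor_section:
  assumes "openin T U" "x \<in> carrier (sections \<O>\<^sub>Y U)" "y \<in> carrier (sections \<O>\<^sub>Y U)"
  shows "simple_tensor (sections \<O>\<^sub>Z U) (sections Alg U) (sections Alg U) x y
    \<in> carrier (sections (tensor_presheaf \<O>\<^sub>Z Alg Alg) U)"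
  using module_pair.simple_tensor_closed[of "sections \<O>\<^sub>Z U" "sections Alg U" "sections Alg U" x y]
    algebra_module assms
  by (simp add: module_pair_def)

text \<open>A tensor of sections is the family of germs of a simple tensor, so evaluation on
  canonical sections followed by evaluation on simple tensors returns the defect.\<close>

lemma on_tensors_sheaf_cocycle:
  assumes "openin T U" "x \<in> carrier (sections \<O>\<^sub>Y U)" "y \<in> carrier (sections \<O>\<^sub>Y U)"
  shows "on_tensors T \<O>\<^sub>Z \<O>\<^sub>Y h sheaf_cocycle U x y = local_cocycle U x y"
  unfolding on_tensors_def tensor_section_def sheaf_cocycle_def
    f.sheafify_lift_germ_section[OF assms(1) simple_tensor_section[OF assms]]
  using bilinear_map.tensor_lift_simple[OF local_cocycle_bilinear[OF assms(1)], of x y] assms by simp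

text \<open>For an arbitrary f, as in the second half of the theorem, this provides the closure that
  \<open>twisted_ring_monoid\<close> asks of \<open>b\<close>.\<close>

lemma on_tensors_closed:
  assumes f: "module_sheaf_hom T \<O>\<^sub>Z (tensor_sheaf T \<O>\<^sub>Z Alg Alg) F\<^sub>Z f"
    and "openin T U" "x \<in> carrier (sections \<O>\<^sub>Y U)" "y \<in> carrier (sections \<O>\<^sub>Y U)"
  shows "on_tensors T \<O>\<^sub>Z \<O>\<^sub>Y h f U x y \<in> carrier (sections F U)"
proof -
  have "tensor_section T \<O>\<^sub>Z Alg Alg U x y \<in> carrier (sections (tensor_sheaf T \<O>\<^sub>Z Alg Alg) U)"
    unfolding tensor_section_def tensor_sheaf_def
    by (rule f.germ_section_closed[OF assms(2) simple_tensor_section[OF assms(2-)]])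
  moreover have "f U \<in> carrier (sections (tensor_sheaf T \<O>\<^sub>Z Alg Alg) U) \<rightarrow> carrier (sections F U)"
    using f assms(2) by (simp add: module_sheaf_hom_def linear_maps_def)
  ultimately show ?thesis
    unfolding on_tensors_def by blast
qed

text \<open>On sections the values of \<open>sheaf_cocycle\<close> are the defects, so each
  statement is a translation of its ring-level counterpart.\<close>

lemma local_structure:
  assumes U: "openin T U"
  shows "cocycle (sections \<O>\<^sub>Y U) (sections F U) (on_tensors T \<O>\<^sub>Z \<O>\<^sub>Y h sheaf_cocycle U)"
    "symmetric_on (carrier (sections \<O>\<^sub>Y U)) (on_tensors T \<O>\<^sub>Z \<O>\<^sub>Y h sheaf_cocycle U)"
    "cring (twisted_ring (sections \<O>\<^sub>Y U) (sections F U) (on_tensors T \<O>\<^sub>Z \<O>\<^sub>Y h sheaf_cocycle U))"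
    "\<Phi> U \<in> ring_iso (twisted_ring (sections \<O>\<^sub>Y U) (sections F U) (on_tensors T \<O>\<^sub>Z \<O>\<^sub>Y h sheaf_cocycle U)) (sections \<O>\<^sub>X U)"
    "\<lbrakk>x \<in> carrier (sections \<O>\<^sub>Y U); m \<in> carrier (sections F U)\<rbrakk> \<Longrightarrow> \<pi> U (\<Phi> U (x, m)) = x"
    "m \<in> carrier (sections F U) \<Longrightarrow> \<Phi> U (\<zero>\<^bsub>sections \<O>\<^sub>Y U\<^esub>, m) = \<iota> U m"
proof -
  interpret U: split_square_zero_extension "sections \<O>\<^sub>Y U" "sections \<O>\<^sub>X U" "sections F U" "\<pi> U" "\<iota> U" "\<sigma> U"
    by (rule local_extension[OF U])
  have eq: "on_tensors T \<O>\<^sub>Z \<O>\<^sub>Y h sheaf_cocycle U x y = U.defect x y"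
    if "x \<in> carrier (sections \<O>\<^sub>Y U)" "y \<in> carrier (sections \<O>\<^sub>Y U)" for x y
    using on_tensors_sheaf_cocycle[OF U that] by (simp add: local_cocycle_def)
  show "cocycle (sections \<O>\<^sub>Y U) (sections F U) (on_tensors T \<O>\<^sub>Z \<O>\<^sub>Y h sheaf_cocycle U)"
    using U.defect_cocycle by (simp add: cocycle_def eq)
  show "symmetric_on (carrier (sections \<O>\<^sub>Y U)) (on_tensors T \<O>\<^sub>Z \<O>\<^sub>Y h sheaf_cocycle U)"
    using U.defect_symmetric by (simp add: symmetric_on_def eq)
  show "cring (twisted_ring (sections \<O>\<^sub>Y U) (sections F U) (on_tensors T \<O>\<^sub>Z \<O>\<^sub>Y h sheaf_cocycle U))"
    "\<Phi> U \<in> ring_iso (twisted_ring (sections \<O>\<^sub>Y U) (sections F U) (on_tensors T \<O>\<^sub>Z \<O>\<^sub>Y h sheaf_cocycle U)) (sections \<O>\<^sub>X U)"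
    unfolding \<Phi>_def by (rule U.twisted_ring_iso, rule eq; assumption)+
  show "\<lbrakk>x \<in> carrier (sections \<O>\<^sub>Y U); m \<in> carrier (sections F U)\<rbrakk> \<Longrightarrow> \<pi> U (\<Phi> U (x, m)) = x"
    "m \<in> carrier (sections F U) \<Longrightarrow> \<Phi> U (\<zero>\<^bsub>sections \<O>\<^sub>Y U\<^esub>, m) = \<iota> U m"
    by (simp_all add: \<Phi>_def U.proj_splitting U.splitting_zero)
qed

end

text \<open>The second conjunct quantifies over every linear f, so that it records the implications
  themselves: condition 1 gives associativity and the stated unit, condition 2 gives commutativity.
  The two equations for \<open>\<pi>\<close> and \<open>\<iota>\<close> in the first conjunct say
  that \<open>\<Phi>\<close> is an isomorphism of extensions and not merely of modules.\<close>

theorem lemma1p1: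
  fixes T :: "'p topology"
    and \<O>\<^sub>Y :: "('p, 'y) ring_presheaf"
    and \<O>\<^sub>Z :: "('p, 'z) ring_presheaf"
    and \<O>\<^sub>X :: "('p, 'x) ring_presheaf"
    and F :: "('p, 'y, 'm) module_presheaf"
    and h :: "'p set \<Rightarrow> 'z \<Rightarrow> 'y"
    and g :: "'p set \<Rightarrow> 'z \<Rightarrow> 'x"
    and \<pi> :: "'p set \<Rightarrow> 'x \<Rightarrow> 'y"
    and \<iota> :: "'p set \<Rightarrow> 'm \<Rightarrow> 'x"
  assumes "scheme T \<O>\<^sub>Y" and "scheme T \<O>\<^sub>Z"
    and "scheme_morphism T \<O>\<^sub>Y \<O>\<^sub>Z h"
    and "coherent_sheaf T \<O>\<^sub>Y F"
    and "infinitesimal_extension T \<O>\<^sub>Y F \<O>\<^sub>X \<pi> \<iota>"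
    and "scheme_morphism T \<O>\<^sub>X \<O>\<^sub>Z g"
    and "\<And>U s. openin T U \<Longrightarrow> s \<in> carrier (sections \<O>\<^sub>Z U) \<Longrightarrow> \<pi> U (g U s) = h U s"
    and "split_extension T \<O>\<^sub>Z (algebra_sheaf g \<O>\<^sub>X) (algebra_sheaf h \<O>\<^sub>Y) \<pi>"
  shows "(\<exists>\<Phi> f.
      module_sheaf_iso T \<O>\<^sub>Z (direct_sum (algebra_sheaf h \<O>\<^sub>Y) (restrict_scalars h F))
        (algebra_sheaf g \<O>\<^sub>X) \<Phi> \<and>
      (\<forall>U. openin T U \<longrightarrow>
        (\<forall>x \<in> carrier (sections \<O>\<^sub>Y U). \<forall>m \<in> carrier (sections F U). \<pi> U (\<Phi> U (x, m)) = x) \<and>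
        (\<forall>m \<in> carrier (sections F U). \<Phi> U (\<zero>\<^bsub>sections \<O>\<^sub>Y U\<^esub>, m) = \<iota> U m)) \<and>
      module_sheaf_hom T \<O>\<^sub>Z (tensor_sheaf T \<O>\<^sub>Z (algebra_sheaf h \<O>\<^sub>Y) (algebra_sheaf h \<O>\<^sub>Y))
        (restrict_scalars h F) f \<and>
      (\<forall>U. affine_open T \<O>\<^sub>Y U \<longrightarrow>
        cocycle (sections \<O>\<^sub>Y U) (sections F U) (on_tensors T \<O>\<^sub>Z \<O>\<^sub>Y h f U) \<and>
        symmetric_on (carrier (sections \<O>\<^sub>Y U)) (on_tensors T \<O>\<^sub>Z \<O>\<^sub>Y h f U) \<and>
        cring (twisted_ring (sections \<O>\<^sub>Y U) (sections F U) (on_tensors T \<O>\<^sub>Z \<O>\<^sub>Y h f U)) \<and>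
        \<Phi> U \<in> ring_iso (twisted_ring (sections \<O>\<^sub>Y U) (sections F U) (on_tensors T \<O>\<^sub>Z \<O>\<^sub>Y h f U))
          (sections \<O>\<^sub>X U)))
    \<and> (\<forall>f U.
      module_sheaf_hom T \<O>\<^sub>Z (tensor_sheaf T \<O>\<^sub>Z (algebra_sheaf h \<O>\<^sub>Y) (algebra_sheaf h \<O>\<^sub>Y))
        (restrict_scalars h F) f \<longrightarrow>
      affine_open T \<O>\<^sub>Y U \<longrightarrow>
      (cocycle (sections \<O>\<^sub>Y U) (sections F U) (on_tensors T \<O>\<^sub>Z \<O>\<^sub>Y h f U) \<longrightarrow>
        Group.monoid (twisted_ring (sections \<O>\<^sub>Y U) (sections F U) (on_tensors T \<O>\<^sub>Z \<O>\<^sub>Y h f U))) \<and>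
      (symmetric_on (carrier (sections \<O>\<^sub>Y U)) (on_tensors T \<O>\<^sub>Z \<O>\<^sub>Y h f U) \<longrightarrow>
        (\<forall>a \<in> carrier (twisted_ring (sections \<O>\<^sub>Y U) (sections F U) (on_tensors T \<O>\<^sub>Z \<O>\<^sub>Y h f U)).
         \<forall>b \<in> carrier (twisted_ring (sections \<O>\<^sub>Y U) (sections F U) (on_tensors T \<O>\<^sub>Z \<O>\<^sub>Y h f U)).
           a \<otimes>\<^bsub>twisted_ring (sections \<O>\<^sub>Y U) (sections F U) (on_tensors T \<O>\<^sub>Z \<O>\<^sub>Y h f U)\<^esub> b =
           b \<otimes>\<^bsub>twisted_ring (sections \<O>\<^sub>Y U) (sections F U) (on_tensors T \<O>\<^sub>Z \<O>\<^sub>Y h f U)\<^esub> a)))"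
proof -
  from assms(8) obtain \<sigma> where "module_sheaf_hom T \<O>\<^sub>Z (algebra_sheaf h \<O>\<^sub>Y) (algebra_sheaf g \<O>\<^sub>X) \<sigma>"
    and "\<And>U y. \<lbrakk>openin T U; y \<in> carrier (sections \<O>\<^sub>Y U)\<rbrakk> \<Longrightarrow> \<pi> U (\<sigma> U y) = y"
    by (auto simp: split_extension_def)
  moreover have "module_sheaf T \<O>\<^sub>Y F"
    using assms(4) by (simp add: coherent_sheaf_def)
  ultimately interpret split_infinitesimal_extension T \<O>\<^sub>Y F \<O>\<^sub>X \<pi> \<iota> \<O>\<^sub>Z h g \<sigma>
    using assms(2,3,5,6,7)
    by (simp add: split_infinitesimal_extension_def split_infinitesimal_extension_axioms_def
        scheme_def scheme_morphism_def)
  have affine: "openin T U" if "affine_open T \<O>\<^sub>Y U" for U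
    using that by (simp add: affine_open_def)
  show ?thesis (is "(\<exists>\<Phi> f. ?P \<Phi> f) \<and> ?Q")
  proof
    have "?P \<Phi> sheaf_cocycle"
      by (intro conjI allI impI ballI splitting_iso sheaf_cocycle_hom local_structure;
          (assumption | erule affine))
    then show "\<exists>\<Phi> f. ?P \<Phi> f" by blast
    show ?Q
      by (intro conjI allI impI ballI;
          (rule twisted_ring_monoid twisted_ring_mult_comm; (intro F.sections_module on_tensors_closed affine)?);
          assumption)
  qed
qed

end
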